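(* Let $(M,\sigma)$ be a smooth flow on a compact smooth manifold $M$, and let $\alpha_t f=f\circ\sigma_t$ for $f\in C^\infty(M)$, $t\in\mathbb{R}$. The Lie group $C^\infty(M)\rtimes_\alpha\mathbb{R}$ is not locally exponential if any of the following conditions holds: (1) The flow has at least one non-periodic, locally closed orbit. (2) The flow restricts to a non-trivial linear flow on a torus embedded in $M$. (3) $M$ admits an equivariant submersion onto a fixed-point-free (smooth) flow on $\mathbb{S}^1$. (4) $M$ admits an equivariant submersion onto a non-trivial linear flow on a torus.
   Context: A smooth flow $\sigma=(\sigma_t)_{t\in\mathbb{R}}$ on $M$ is a smooth action of $\mathbb{R}$ on $M$. An orbit $\sigma_{\mathbb{R}}(p)=\{\sigma_t(p):t\in\mathbb{R}\}$ is non-periodic if the orbit map $t\mapsto\sigma_t(p)$ is not periodic (in particular $p$ is not a fixed point), and locally closed if it is open in its closure. A linear flow on a torus $\mathbb{T}^d=(\mathbb{S}^1)^d$ is one of the form (after identification by a diffeomorphism) $\sigma_t(z_1,\dots,z_d)=(e^{it\theta_1}z_1,\dots,e^{it\theta_d}z_d)$ with $(\theta_1,\dots,\theta_d)\in\mathbb{R}^d$; it is non-trivial if $(\theta_j)_j\neq 0$. An equivariant submersion of $(M,\sigma)$ onto a flow $(N,\sigma^N)$ is a surjective smooth submersion $\pi:M\to N$ with $\pi\circ\sigma_t=\sigma^N_t\circ\pi$ for all $t$. $C^\infty(M)=C^\infty(M,\mathbb{R})$ is a Fréchet space with the topology of uniform convergence of all derivatives (in charts, on compact sets). $C^\infty(M)\rtimes_\alpha\mathbb{R}$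 is the Fréchet--Lie group on $C^\infty(M)\times\mathbb{R}$ with product $(f,t)(g,s)=(f+\alpha_t g,t+s)$. Its exponential function is $(f,t)\mapsto(\beta_t f,t)$ with $\beta_t=\int_0^1\alpha_{st}\,ds$. A Lie group is locally exponential if it has a (smooth) exponential function which maps some open $0$-neighborhood of the Lie algebra diffeomorphically onto an open identity neighborhood of the group (smoothness in the Bastiani sense: all iterated directional derivatives exist and are jointly continuous). *)

theory Defs
  imports "HOL-Analysis.Analysis" "HOL-Library.Function_Algebras" "HOL-Algebra.Group"
begin

section \<open>Smooth functions on open subsets of Euclidean spaces\<close>

primrec dir_derivs ::
  "('e::real_normed_vector \<Rightarrow> 'f::real_normed_vector) \<Rightarrow> 'e list \<Rightarrow> 'e \<Rightarrow> 'f" where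
  "dir_derivs f [] = f"
| "dir_derivs f (v # vs) = (\<lambda>x. frechet_derivative (dir_derivs f vs) (at x) v)"

text \<open>Only used for open sets, and for finite-dimensional domains.\<close>

definition smooth_on ::
  "'e::euclidean_space set \<Rightarrow> ('e \<Rightarrow> 'f::real_normed_vector) \<Rightarrow> bool" where
  "smooth_on S f \<longleftrightarrow>
     (\<forall>vs. continuous_on S (dir_derivs f vs) \<and> (\<forall>x\<in>S. dir_derivs f vs differentiable (at x)))"


section \<open>Smooth manifolds\<close>

text \<open>
  A chart is a pair of a domain and a coordinate map; values of the coordinate map outside of its
  domain are irrelevant. A manifold is a topology together with a (not necessarily maximal)
  smooth atlas.
\<close>

type_synonym ('a, 'e) chart = "'a set \<times> ('a \<Rightarrow> 'e)"

definition smooth_manifold :: "'a topology \<Rightarrow> ('a, 'e::euclidean_space) chart set \<Rightarrow> bool" where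
  "smooth_manifold X A \<longleftrightarrow>
     Hausdorff_space X \<and>
     (\<exists>\<B>. countable \<B> \<and> (\<forall>B\<in>\<B>. openin X B) \<and>
        (\<forall>U x. openin X U \<and> x \<in> U \<longrightarrow> (\<exists>B\<in>\<B>. x \<in> B \<and> B \<subseteq> U))) \<and>
     (\<Union>(U, \<phi>)\<in>A. U) = topspace X \<and>
     (\<forall>(U, \<phi>)\<in>A. openin X U \<and> open (\<phi> ` U) \<and>
        homeomorphic_map (subtopology X U) (top_of_set (\<phi> ` U)) \<phi>) \<and>
     (\<forall>(U, \<phi>)\<in>A. \<forall>(V, \<psi>)\<in>A. smooth_on (\<phi> ` (U \<inter> V)) (\<psi> \<circ> inv_into U \<phi>))"

definition smooth_map ::
  "'a topology \<Rightarrow> ('a, 'e::euclidean_space) chart set \<Rightarrow>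
   'b topology \<Rightarrow> ('b, 'f::euclidean_space) chart set \<Rightarrow> ('a \<Rightarrow> 'b) \<Rightarrow> bool" where
  "smooth_map X A Y B f \<longleftrightarrow>
     continuous_map X Y f \<and>
     (\<forall>(U, \<phi>)\<in>A. \<forall>(V, \<psi>)\<in>B. smooth_on (\<phi> ` (U \<inter> f -` V)) (\<psi> \<circ> f \<circ> inv_into U \<phi>))"

definition submersion ::
  "'a topology \<Rightarrow> ('a, 'e::euclidean_space) chart set \<Rightarrow>
   'b topology \<Rightarrow> ('b, 'f::euclidean_space) chart set \<Rightarrow> ('a \<Rightarrow> 'b) \<Rightarrow> bool" where
  "submersion X A Y B f \<longleftrightarrow>
     smooth_map X A Y B f \<and>
     (\<forall>(U, \<phi>)\<in>A. \<forall>(V, \<psi>)\<in>B. \<forall>x \<in> U \<inter> f -` V.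
        surj (frechet_derivative (\<psi> \<circ> f \<circ> inv_into U \<phi>) (at (\<phi> x))))"

definition smooth_embedding ::
  "'a topology \<Rightarrow> ('a, 'e::euclidean_space) chart set \<Rightarrow>
   'b topology \<Rightarrow> ('b, 'f::euclidean_space) chart set \<Rightarrow> ('a \<Rightarrow> 'b) \<Rightarrow> bool" where
  "smooth_embedding X A Y B f \<longleftrightarrow>
     smooth_map X A Y B f \<and>
     (\<forall>(U, \<phi>)\<in>A. \<forall>(V, \<psi>)\<in>B. \<forall>x \<in> U \<inter> f -` V.
        inj (frechet_derivative (\<psi> \<circ> f \<circ> inv_into U \<phi>) (at (\<phi> x)))) \<and>
     embedding_map X Y f"

definition euclidean_atlas :: "('e, 'e::euclidean_space) chart set" where
  "euclidean_atlas = {(UNIV, id)}"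

definition prod_atlas ::
  "('a, 'e) chart set \<Rightarrow> ('b, 'f) chart set \<Rightarrow> ('a \<times> 'b, 'e \<times> 'f) chart set" where
  "prod_atlas A B = {(U \<times> V, map_prod \<phi> \<psi>) | U \<phi> V \<psi>. (U, \<phi>) \<in> A \<and> (V, \<psi>) \<in> B}"


section \<open>Circle and tori\<close>

text \<open>The charts are the local inverses of the covering maps \<open>\<real> \<rightarrow> S\<^sup>1\<close> and \<open>\<real>\<^sup>d \<rightarrow> T\<^sup>d\<close>.\<close>

definition circle :: "complex topology" where
  "circle = top_of_set (sphere 0 1)"

definition circle_atlas :: "(complex, real) chart set" where
  "circle_atlas = (\<Union>a. {(cis ` {a - pi <..< a + pi}, inv_into {a - pi <..< a + pi} cis)})"

definition torus :: "(complex ^ 'd) topology" where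
  "torus = top_of_set {z. \<forall>j. z $ j \<in> sphere 0 1}"

definition torus_cover :: "real ^ 'd \<Rightarrow> complex ^ 'd" where
  "torus_cover x = (\<chi> j. cis (x $ j))"

definition torus_atlas :: "(complex ^ 'd, real ^ 'd) chart set" where
  "torus_atlas = (\<Union>a. let Q = {x. \<forall>j. x $ j \<in> {a $ j - pi <..< a $ j + pi}} in
                        {(torus_cover ` Q, inv_into Q torus_cover)})"


section \<open>Flows\<close>

definition smooth_flow ::
  "'a topology \<Rightarrow> ('a, 'e::euclidean_space) chart set \<Rightarrow> (real \<Rightarrow> 'a \<Rightarrow> 'a) \<Rightarrow> bool" where
  "smooth_flow X A \<sigma> \<longleftrightarrow>
     smooth_map (prod_topology euclideanreal X) (prod_atlas euclidean_atlas A) X A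
       (\<lambda>(t, x). \<sigma> t x) \<and>
     (\<forall>x\<in>topspace X. \<sigma> 0 x = x) \<and>
     (\<forall>s t. \<forall>x\<in>topspace X. \<sigma> (s + t) x = \<sigma> s (\<sigma> t x))"

definition orbit :: "(real \<Rightarrow> 'a \<Rightarrow> 'a) \<Rightarrow> 'a \<Rightarrow> 'a set" where
  "orbit \<sigma> p = range (\<lambda>t. \<sigma> t p)"

definition periodic_orbit :: "(real \<Rightarrow> 'a \<Rightarrow> 'a) \<Rightarrow> 'a \<Rightarrow> bool" where
  "periodic_orbit \<sigma> p \<longleftrightarrow> (\<exists>T>0. \<forall>t. \<sigma> (t + T) p = \<sigma> t p)"

definition locally_closed_in :: "'a topology \<Rightarrow> 'a set \<Rightarrow> bool" where
  "locally_closed_in X S \<longleftrightarrow> openin (subtopology X (X closure_of S)) S"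

definition fixed_point_free :: "'a topology \<Rightarrow> (real \<Rightarrow> 'a \<Rightarrow> 'a) \<Rightarrow> bool" where
  "fixed_point_free X \<sigma> \<longleftrightarrow> \<not> (\<exists>x\<in>topspace X. \<forall>t. \<sigma> t x = x)"

definition equivariant ::
  "'a topology \<Rightarrow> (real \<Rightarrow> 'a \<Rightarrow> 'a) \<Rightarrow> (real \<Rightarrow> 'b \<Rightarrow> 'b) \<Rightarrow> ('a \<Rightarrow> 'b) \<Rightarrow> bool" where
  "equivariant X \<sigma> \<tau> f \<longleftrightarrow> (\<forall>t. \<forall>x\<in>topspace X. f (\<sigma> t x) = \<tau> t (f x))"

definition equivariant_submersion_onto ::
  "'a topology \<Rightarrow> ('a, 'e::euclidean_space) chart set \<Rightarrow> (real \<Rightarrow> 'a \<Rightarrow> 'a) \<Rightarrow>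
   'b topology \<Rightarrow> ('b, 'f::euclidean_space) chart set \<Rightarrow> (real \<Rightarrow> 'b \<Rightarrow> 'b) \<Rightarrow>
   ('a \<Rightarrow> 'b) \<Rightarrow> bool" where
  "equivariant_submersion_onto X A \<sigma> Y B \<tau> f \<longleftrightarrow>
     submersion X A Y B f \<and> f ` topspace X = topspace Y \<and> equivariant X \<sigma> \<tau> f"

definition linear_flow :: "real ^ 'd \<Rightarrow> real \<Rightarrow> complex ^ 'd \<Rightarrow> complex ^ 'd" where
  "linear_flow \<theta> t z = (\<chi> j. cis (t * \<theta> $ j) * z $ j)"


section \<open>Bastiani calculus\<close>

text \<open>Pointwise scalar multiplication, so that spaces of real functions are real vector spaces.\<close>

instantiation "fun" :: (type, real_vector) real_vector
begin

definition scaleR_fun :: "real \<Rightarrow> ('a \<Rightarrow> 'b) \<Rightarrow> 'a \<Rightarrow> 'b" where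
  "scaleR_fun c f = (\<lambda>x. c *\<^sub>R f x)"

instance
  by standard (simp_all add: scaleR_fun_def fun_eq_iff scaleR_add_left scaleR_add_right)

end

text \<open>
  A locally convex space is given by a topology \<open>E\<close> whose carrier \<open>topspace E\<close> is a linear
  subspace of the ambient type.
\<close>

definition has_dir_deriv ::
  "'w::real_vector topology \<Rightarrow> ('v::real_vector \<Rightarrow> 'w) \<Rightarrow> 'v \<Rightarrow> 'v \<Rightarrow> 'w \<Rightarrow> bool" where
  "has_dir_deriv F f x v D \<longleftrightarrow>
     limitin F (\<lambda>t::real. (1 / t) *\<^sub>R (f (x + t *\<^sub>R v) - f x)) D (at 0)"

text \<open>\<open>iter_deriv F f k x v\<close> is \<open>d\<^sup>kf(x; v\<^sub>0, \<dots>, v\<^sub>k\<^sub>-\<^sub>1)\<close>; it only depends on \<open>v\<close> below \<open>k\<close>.\<close>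

primrec iter_deriv ::
  "'w::real_vector topology \<Rightarrow> ('v::real_vector \<Rightarrow> 'w) \<Rightarrow> nat \<Rightarrow> 'v \<Rightarrow> (nat \<Rightarrow> 'v) \<Rightarrow> 'w" where
  "iter_deriv F f 0 x v = f x"
| "iter_deriv F f (Suc k) x v = (THE D. has_dir_deriv F (\<lambda>y. iter_deriv F f k y v) x (v k) D)"

definition bastiani_smooth ::
  "'v::real_vector topology \<Rightarrow> 'w::real_vector topology \<Rightarrow> 'v set \<Rightarrow> ('v \<Rightarrow> 'w) \<Rightarrow> bool" where
  "bastiani_smooth E F U f \<longleftrightarrow>
     (\<forall>k. (\<forall>x\<in>U. \<forall>v. (\<forall>i\<le>k. v i \<in> topspace E) \<longrightarrow>
             (\<exists>D. has_dir_deriv F (\<lambda>y. iter_deriv F f k y v) x (v k) D)) \<and>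
          continuous_map
            (prod_topology (subtopology E U) (product_topology (\<lambda>_. E) {..<k})) F
            (\<lambda>(x, v). iter_deriv F f k x v))"


section \<open>Locally exponential Lie groups\<close>

text \<open>
  Here the Lie group \<open>G\<close> has the locally convex space \<open>E\<close> as its underlying manifold (so
  \<open>carrier G = topspace E\<close>, with the identity as global chart), and its Lie algebra, the tangent
  space at the unit, is \<open>E\<close> as a locally convex space.
\<close>

definition exponential_function ::
  "'v::real_vector topology \<Rightarrow> 'v monoid \<Rightarrow> ('v \<Rightarrow> 'v) \<Rightarrow> bool" where
  "exponential_function E G ex \<longleftrightarrow>
     bastiani_smooth E E (topspace E) ex \<and>
     ex 0 = \<one>\<^bsub>G\<^esub> \<and>
     (\<forall>x\<in>topspace E.
        (\<forall>s t. ex ((s + t) *\<^sub>R x) = ex (s *\<^sub>R x) \<otimes>\<^bsub>G\<^esub> ex (t *\<^sub>R x)) \<and>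
        has_dir_deriv E (\<lambda>t. ex (t *\<^sub>R x)) 0 (1::real) x)"

definition locally_exponential :: "'v::real_vector topology \<Rightarrow> 'v monoid \<Rightarrow> bool" where
  "locally_exponential E G \<longleftrightarrow>
     (\<exists>ex. exponential_function E G ex \<and>
        (\<exists>U V. openin E U \<and> 0 \<in> U \<and> openin E V \<and> \<one>\<^bsub>G\<^esub> \<in> V \<and>
           bij_betw ex U V \<and> bastiani_smooth E E U ex \<and> bastiani_smooth E E V (inv_into U ex)))"


section \<open>The group of a flow\<close>

text \<open>
  Functions on the manifold are represented by functions on the ambient type that vanish outside
  of the carrier.
\<close>

definition Cinf :: "'a topology \<Rightarrow> ('a, 'e::euclidean_space) chart set \<Rightarrow> ('a \<Rightarrow> real) set" where
  "Cinf X A = {f. smooth_map X A euclideanreal euclidean_atlas f \<and> (\<forall>x. x \<notin> topspace X \<longrightarrow> f x = 0)}"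

text \<open>
  Subbasis: balls of the seminorms given by the supremum, over a compact set in a chart domain,
  of a directional derivative of arbitrary order in coordinates.
\<close>

definition Cinf_topology ::
  "'a topology \<Rightarrow> ('a, 'e::euclidean_space) chart set \<Rightarrow> ('a \<Rightarrow> real) topology" where
  "Cinf_topology X A = topology_generated_by (insert (Cinf X A)
     {{g \<in> Cinf X A. \<forall>y\<in>K. \<bar>dir_derivs (g \<circ> inv_into U \<phi>) vs y - dir_derivs (f \<circ> inv_into U \<phi>) vs y\<bar> < \<epsilon>}
       | f U \<phi> K vs \<epsilon>. f \<in> Cinf X A \<and> (U, \<phi>) \<in> A \<and> compact K \<and> K \<subseteq> \<phi> ` U \<and> \<epsilon> > 0})"

definition flow_action ::
  "'a topology \<Rightarrow> (real \<Rightarrow> 'a \<Rightarrow> 'a) \<Rightarrow> real \<Rightarrow> ('a \<Rightarrow> real) \<Rightarrow> 'a \<Rightarrow> real" where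
  "flow_action X \<sigma> t f = (\<lambda>x. if x \<in> topspace X then f (\<sigma> t x) else 0)"

definition flow_group ::
  "'a topology \<Rightarrow> ('a, 'e::euclidean_space) chart set \<Rightarrow> (real \<Rightarrow> 'a \<Rightarrow> 'a) \<Rightarrow>
   (('a \<Rightarrow> real) \<times> real) monoid" where
  "flow_group X A \<sigma> =
     \<lparr>carrier = Cinf X A \<times> UNIV,
      mult = (\<lambda>(f, t) (g, s). (f + flow_action X \<sigma> t g, t + s)),
      one = (0, 0)\<rparr>"

definition flow_group_topology ::
  "'a topology \<Rightarrow> ('a, 'e::euclidean_space) chart set \<Rightarrow> (('a \<Rightarrow> real) \<times> real) topology" where
  "flow_group_topology X A = prod_topology (Cinf_topology X A) euclideanreal"

end

theory Submission
  imports Defs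
begin

text \<open>
  The exponential function is \<open>exp (f, t) = (\<beta>\<^sub>t f, t)\<close>, so local exponentiality makes \<open>\<beta>\<^sub>t\<close>
  surjective on smooth functions for all small \<open>t > 0\<close>, with \<open>\<beta>\<^sub>t\<^sup>-\<^sup>1 g\<close> depending continuously on
  \<open>t\<close> in the supremum norm. If \<open>g = \<beta>\<^sub>t f\<close>, then the sums \<open>\<Sum>k<N. g (\<sigma> (k t) p)\<close> and
  \<open>\<Sum>k<N. g (\<sigma> (k t + t/2) p)\<close> differ by a quantity bounded in \<open>N\<close>, since \<open>t\<close> times either of
  them is an integral of \<open>f\<close> along the orbit.

  In cases (2), (3) and (4) there is a continuous equivariant map to a rotating circle (defined on
  the embedded torus or on all of \<open>M\<close>). If \<open>t\<close> is the \<open>n\<close>-th part of the period, the two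
  sequences of orbit points stay in disjoint closed sets, and a smooth function which is positive on
  one and zero on the other contradicts this bound.

  In case (1) take a bump function \<open>g\<close> at \<open>p\<close> which sees the orbit only for times in a small
  interval around \<open>0\<close>. Along the orbit, \<open>\<beta>\<^sub>t\<^sup>-\<^sup>1 g\<close> is then \<open>t\<close>-periodic on both ends. Being a
  uniform limit of functions with slightly different periods it is constant there, hence zero as its
  mean is zero; the two ends overlap, so \<open>g p = 0\<close>.
\<close>

section \<open>Calculus of smooth functions\<close>

text \<open>Here the first derivative is peeled off on the inside, whereas \<open>dir_derivs\<close>
  puts new derivatives on the outside. This order suits induction on \<open>k\<close> with the
  function generalized, as used for products and compositions.\<close>

primrec times_differentiable_on ::
  "nat \<Rightarrow> 'e::real_normed_vector set \<Rightarrow> ('e \<Rightarrow> 'f::real_normed_vector) \<Rightarrow> bool" where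
  "times_differentiable_on 0 S f \<longleftrightarrow> True"
| "times_differentiable_on (Suc k) S f \<longleftrightarrow>
     (\<forall>x\<in>S. f differentiable (at x)) \<and>
     (\<forall>v. times_differentiable_on k S (\<lambda>x. frechet_derivative f (at x) v))"

lemma dir_derivs_snoc:
  "dir_derivs f (vs @ [v]) = dir_derivs (\<lambda>x. frechet_derivative f (at x) v) vs"
  by (induction vs) auto

lemma times_differentiable_on_iff_dir_derivs:
  "times_differentiable_on k S f \<longleftrightarrow>
     (\<forall>vs. length vs < k \<longrightarrow> (\<forall>x\<in>S. dir_derivs f vs differentiable (at x)))"
proof (induction k arbitrary: f)
  case (Suc k)
  show ?case
  proof
    assume L: "times_differentiable_on (Suc k) S f"
    show "\<forall>vs. length vs < Suc k \<longrightarrow> (\<forall>x\<in>S. dir_derivs f vs differentiable (at x))"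
    proof (intro allI impI)
      fix vs :: "'a list" assume "length vs < Suc k"
      then show "\<forall>x\<in>S. dir_derivs f vs differentiable (at x)"
        using L Suc.IH by (cases vs rule: rev_cases) (auto simp: dir_derivs_snoc)
    qed
  next
    assume R: "\<forall>vs. length vs < Suc k \<longrightarrow> (\<forall>x\<in>S. dir_derivs f vs differentiable (at x))"
    have "\<forall>x\<in>S. dir_derivs (\<lambda>x. frechet_derivative f (at x) v) vs differentiable (at x)"
      if "length vs < k" for v vs
      using R[rule_format, of "vs @ [v]"] that by (simp add: dir_derivs_snoc)
    then show "times_differentiable_on (Suc k) S f"
      using R[rule_format, of "[]"] Suc.IH by simp
  qed
qed auto

text \<open>Each iterated derivative is continuous because it is itself differentiable at every
  point of \<open>S\<close>, so smoothness reduces to counting orders.\<close>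

lemma smooth_on_iff: "smooth_on S f \<longleftrightarrow> (\<forall>k. times_differentiable_on k S f)"
  unfolding smooth_on_def times_differentiable_on_iff_dir_derivs
  by (meson continuous_at_imp_continuous_on differentiable_imp_continuous_within lessI)

lemma frechet_derivative_cong_open:
  assumes "open S" "x \<in> S" "\<And>y. y \<in> S \<Longrightarrow> f y = g y" "f differentiable (at x)"
  shows "g differentiable (at x)" "frechet_derivative g (at x) = frechet_derivative f (at x)"
proof -
  have "(f has_derivative frechet_derivative f (at x)) (at x)"
    using assms(4) frechet_derivative_works by blast
  then have "(g has_derivative frechet_derivative f (at x)) (at x)"
    using has_derivative_transform_within_open assms by blast
  then show "g differentiable (at x)" "frechet_derivative g (at x) = frechet_derivative f (at x)"
    using differentiableI frechet_derivative_at by metis+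
qed

lemma times_differentiable_on_cong:
  assumes "open S" "\<And>y. y \<in> S \<Longrightarrow> f y = g y" "times_differentiable_on k S f"
  shows "times_differentiable_on k S g"
  using assms(2,3)
proof (induction k arbitrary: f g)
  case (Suc k)
  have D: "\<forall>x\<in>S. f differentiable (at x)"
    using Suc.prems by simp
  show ?case
    using Suc.IH[of "\<lambda>x. frechet_derivative f (at x) _" "\<lambda>x. frechet_derivative g (at x) _"]
      Suc.prems frechet_derivative_cong_open[OF assms(1) _ Suc.prems(1)] D by auto
qed simp

lemma times_differentiable_on_Suc_imp:
  "times_differentiable_on (Suc k) S f \<Longrightarrow> times_differentiable_on k S f"
  by (induction k arbitrary: f) auto

text \<open>Lets the derivative be given by a formula \<open>D v x\<close> valid on \<open>S\<close>
  only; congruence on the open set then replaces \<open>frechet_derivative\<close> by it.\<close>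

lemma times_differentiable_on_SucI:
  assumes "open S" "\<And>x. x \<in> S \<Longrightarrow> (f has_derivative (\<lambda>v. D v x)) (at x)"
    "\<And>v. times_differentiable_on k S (D v)"
  shows "times_differentiable_on (Suc k) S f"
proof -
  have eq: "frechet_derivative f (at x) = (\<lambda>v. D v x)" if "x \<in> S" for x
    using assms(2)[OF that] frechet_derivative_at by metis
  have "times_differentiable_on k S (\<lambda>x. frechet_derivative f (at x) v)" for v
    by (rule times_differentiable_on_cong[OF assms(1) _ assms(3)[of v]]) (simp add: eq)
  then show ?thesis
    using assms(2) by (auto intro: differentiableI)
qed

lemma times_differentiable_on_Suc_has_derivative:
  assumes "times_differentiable_on (Suc k) S f" "x \<in> S"
  shows "(f has_derivative frechet_derivative f (at x)) (at x)"
  using assms frechet_derivative_works by auto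

lemma times_differentiable_on_const: "open S \<Longrightarrow> times_differentiable_on k S (\<lambda>_. c)"
proof (induction k arbitrary: c)
  case (Suc k)
  show ?case
    by (rule times_differentiable_on_SucI[where D = "\<lambda>_ _. 0"]) (use Suc in auto)
qed simp

lemma times_differentiable_on_bounded_linear:
  assumes "open S" "bounded_linear h" "times_differentiable_on k S f"
  shows "times_differentiable_on k S (\<lambda>x. h (f x))"
  using assms(3)
proof (induction k arbitrary: f)
  case (Suc k)
  show ?case
    by (rule times_differentiable_on_SucI[OF assms(1),
            where D = "\<lambda>v x. h (frechet_derivative f (at x) v)"])
       (use Suc in \<open>auto intro!: bounded_linear.has_derivative[OF assms(2)]
          simp flip: frechet_derivative_works\<close>)
qed simp

lemma times_differentiable_on_add:
  assumes "open S" "times_differentiable_on k S f" "times_differentiable_on k S g"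
  shows "times_differentiable_on k S (\<lambda>x. f x + g x)"
  using assms(2,3)
proof (induction k arbitrary: f g)
  case (Suc k)
  show ?case
    by (rule times_differentiable_on_SucI[OF assms(1),
            where D = "\<lambda>v x. frechet_derivative f (at x) v + frechet_derivative g (at x) v"])
       (use Suc in \<open>auto intro!: has_derivative_add simp flip: frechet_derivative_works\<close>)
qed simp

lemma times_differentiable_on_sum:
  assumes "open S" "\<And>i. i \<in> I \<Longrightarrow> times_differentiable_on k S (f i)"
  shows "times_differentiable_on k S (\<lambda>x. \<Sum>i\<in>I. f i x)"
  using assms(2)
  by (induction I rule: infinite_finite_induct)
     (auto intro!: times_differentiable_on_add assms(1) times_differentiable_on_const)

lemma times_differentiable_on_scaleR:
  fixes f :: "'e::real_normed_vector \<Rightarrow> real"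
  assumes "open S" "times_differentiable_on k S f" "times_differentiable_on k S g"
  shows "times_differentiable_on k S (\<lambda>x. f x *\<^sub>R g x)"
  using assms(2,3)
proof (induction k arbitrary: f g)
  case (Suc k)
  have *: "times_differentiable_on k S (\<lambda>x. f x *\<^sub>R frechet_derivative g (at x) v
                + frechet_derivative f (at x) v *\<^sub>R g x)" for v
    using Suc.prems times_differentiable_on_Suc_imp[OF Suc.prems(1)]
      times_differentiable_on_Suc_imp[OF Suc.prems(2)]
    by (intro times_differentiable_on_add Suc.IH assms(1)) auto
  show ?case
    by (rule times_differentiable_on_SucI[OF assms(1), where D = "\<lambda>v x. f x *\<^sub>R frechet_derivative g (at x) v
                + frechet_derivative f (at x) v *\<^sub>R g x", OF _ *])
       (intro has_derivative_scaleR times_differentiable_on_Suc_has_derivative[OF Suc.prems(1)]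
          times_differentiable_on_Suc_has_derivative[OF Suc.prems(2)])
qed simp

text \<open>In the chain rule the direction fed to the derivative of \<open>f\<close> varies with
  \<open>x\<close>. Expanding it in the basis of the middle Euclidean space leaves derivatives of
  \<open>f\<close> in fixed directions, composed with \<open>g\<close>, and to these the induction
  hypothesis applies.\<close>

lemma times_differentiable_on_compose:
  fixes g :: "'e::real_normed_vector \<Rightarrow> 'm::euclidean_space"
  assumes "open S" "g ` S \<subseteq> T" "times_differentiable_on k T f" "times_differentiable_on k S g"
  shows "times_differentiable_on k S (\<lambda>x. f (g x))"
  using assms(3,4)
proof (induction k arbitrary: f)
  case (Suc k)
  let ?D = "\<lambda>v x. \<Sum>b\<in>Basis. (frechet_derivative g (at x) v \<bullet> b) *\<^sub>R frechet_derivative f (at (g x)) b"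
  have *: "times_differentiable_on k S (?D v)" for v
    using Suc.prems times_differentiable_on_Suc_imp[OF Suc.prems(2)]
    by (intro times_differentiable_on_sum times_differentiable_on_scaleR assms(1)
        times_differentiable_on_bounded_linear[OF _ bounded_linear_inner_left]
        Suc.IH[of "\<lambda>x. frechet_derivative f (at x) _"]) auto
  have "((\<lambda>x. f (g x)) has_derivative (\<lambda>v. ?D v x)) (at x)" if "x \<in> S" for x
  proof -
    have f: "(f has_derivative frechet_derivative f (at (g x))) (at (g x))"
      using times_differentiable_on_Suc_has_derivative[OF Suc.prems(1), of "g x"] assms(2) that by auto
    have "((\<lambda>x. f (g x)) has_derivative
        (\<lambda>v. frechet_derivative f (at (g x)) (frechet_derivative g (at x) v))) (at x)"
      by (rule has_derivative_compose[OF
            times_differentiable_on_Suc_has_derivative[OF Suc.prems(2) that] f])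
    moreover have expand: "frechet_derivative f (at (g x)) w
        = (\<Sum>b\<in>Basis. (w \<bullet> b) *\<^sub>R frechet_derivative f (at (g x)) b)" for w
    proof -
      interpret bounded_linear "frechet_derivative f (at (g x))"
        using f by (rule has_derivative_bounded_linear)
      have "frechet_derivative f (at (g x)) w
        = frechet_derivative f (at (g x)) (\<Sum>b\<in>Basis. (w \<bullet> b) *\<^sub>R b)"
        by (simp add: euclidean_representation)
      then show ?thesis
        by (simp add: sum scaleR)
    qed
    ultimately show ?thesis
      by (subst (asm) expand)
  qed
  then show ?case
    by (rule times_differentiable_on_SucI[OF assms(1), where D = ?D, OF _ *])
qed simp

lemma times_differentiable_on_id: "open S \<Longrightarrow> times_differentiable_on k S (\<lambda>x. x)"
proof (cases k)
  case (Suc k)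
  show "open S \<Longrightarrow> ?thesis" unfolding Suc
    by (rule times_differentiable_on_SucI[where D = "\<lambda>v _. v"])
       (auto intro: times_differentiable_on_const)
qed simp

text \<open>Differentiability \<open>at x\<close> refers to the whole space, so it is checked point
  by point and \<open>T\<close> may change with the point.\<close>

lemma times_differentiable_on_local:
  assumes "\<And>x. x \<in> S \<Longrightarrow> \<exists>T. x \<in> T \<and> times_differentiable_on k T f"
  shows "times_differentiable_on k S f"
  using assms
proof (induction k arbitrary: f)
  case (Suc k)
  have "times_differentiable_on k S (\<lambda>x. frechet_derivative f (at x) v)" for v
  proof (rule Suc.IH)
    fix x assume "x \<in> S"
    then obtain T where "x \<in> T" "times_differentiable_on (Suc k) T f"
      using Suc.prems by metis
    then show "\<exists>T. x \<in> T \<and> times_differentiable_on k T (\<lambda>x. frechet_derivative f (at x) v)"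
      by auto
  qed
  moreover have "f differentiable (at x)" if x: "x \<in> S" for x
  proof -
    obtain T where "x \<in> T" "times_differentiable_on (Suc k) T f"
      using Suc.prems[OF x] by metis
    then show ?thesis
      by simp
  qed
  ultimately show ?case
    by simp
qed simp

subsection \<open>A flat function\<close>

text \<open>The family is closed under differentiation up to linear combinations.\<close>

definition flat_fun :: "nat \<Rightarrow> real \<Rightarrow> real" where
  "flat_fun n s = (if s > 0 then (1 / s) ^ n * exp (- (1 / s)) else 0)"

text \<open>From the right this is the decay of \<open>x ^ n / exp x\<close> at infinity under
  \<open>x = inverse s\<close>; from the left the function is zero.\<close>

lemma flat_fun_tendsto_0: "((\<lambda>s. flat_fun n s) \<longlongrightarrow> 0) (at 0)"
proof -
  have "((\<lambda>x::real. x ^ n / exp x) \<longlongrightarrow> 0) at_top"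
    by (rule tendsto_power_div_exp_0)
  then have "((\<lambda>s::real. inverse s ^ n / exp (inverse s)) \<longlongrightarrow> 0) (at_right 0)"
    by (rule filterlim_compose[OF _ filterlim_inverse_at_top_right])
  then have "(flat_fun n \<longlongrightarrow> 0) (at_right 0)"
    by (rule Lim_transform_eventually)
       (auto simp: eventually_at flat_fun_def field_simps exp_minus intro!: exI[of _ 1])
  moreover have "(flat_fun n \<longlongrightarrow> 0) (at_left 0)"
    by (rule Lim_transform_eventually[OF tendsto_const])
       (auto simp: eventually_at flat_fun_def intro!: exI[of _ 1])
  ultimately show ?thesis
    using filterlim_split_at_real by blast
qed

lemma flat_fun_has_field_derivative:
  "(flat_fun n has_field_derivative flat_fun (n + 2) s - n * flat_fun (n + 1) s) (at s)"
proof (cases s "0::real" rule: linorder_cases)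
  case less
  have "((\<lambda>_. 0) has_field_derivative 0) (at s)"
    by simp
  then have "(flat_fun n has_field_derivative 0) (at s)"
    by (rule has_field_derivative_transform_within_open[of _ _ _ "{..<0}"])
       (use less in \<open>auto simp: flat_fun_def\<close>)
  then show ?thesis
    using less by (simp add: flat_fun_def)
next
  case equal
  \<comment> \<open>Away from \<open>h = 0\<close> this difference quotient is
    \<open>flat_fun (Suc n)\<close>.\<close>
  have "((\<lambda>h. (flat_fun n (0 + h) - flat_fun n 0) / h) \<longlongrightarrow> 0) (at 0)"
    by (rule Lim_transform_eventually[OF flat_fun_tendsto_0[of "Suc n"]])
       (auto simp: eventually_at flat_fun_def intro!: exI[of _ 1])
  then show ?thesis
    using equal by (simp add: DERIV_def flat_fun_def)
next
  case greater
  have "((\<lambda>s. (1 / s) ^ n * exp (- (1 / s))) has_field_derivative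
      flat_fun (n + 2) s - n * flat_fun (n + 1) s) (at s)"
    using greater
    by (auto intro!: derivative_eq_intros simp: flat_fun_def power2_eq_square)
       (cases n; simp add: field_simps)
  then show ?thesis
    by (rule has_field_derivative_transform_within_open[of _ _ _ "{0<..}"])
       (use greater in \<open>auto simp: flat_fun_def\<close>)
qed

lemma times_differentiable_on_flat_fun: "times_differentiable_on k UNIV (flat_fun n)"
proof (induction k arbitrary: n)
  case (Suc k)
  have "times_differentiable_on k UNIV (\<lambda>s. v *\<^sub>R (flat_fun (n + 2) s + (- real n) *\<^sub>R flat_fun (n + 1) s))"
    for v :: real
    by (intro times_differentiable_on_scaleR times_differentiable_on_add
        times_differentiable_on_const Suc.IH) auto
  then show ?case
    using flat_fun_has_field_derivative[of n]
    by (intro times_differentiable_on_SucI[where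
          D = "\<lambda>v s. v *\<^sub>R (flat_fun (n + 2) s + (- real n) *\<^sub>R flat_fun (n + 1) s)"])
       (auto simp: has_field_derivative_def mult_commute_abs)
qed simp

lemma smooth_ball_bump:
  fixes c :: "'e::euclidean_space"
  assumes "r > 0"
  obtains b :: "'e \<Rightarrow> real" where "\<And>k. times_differentiable_on k UNIV b" "\<And>y. b y \<ge> 0"
    "b c > 0" "\<And>y. y \<notin> cball c r \<Longrightarrow> b y = 0"
proof
  \<comment> \<open>This is r^2 - |y - c|^2, spelled out in sums and scalar multiples so that the
    closure rules for differentiability match. It is positive at the centre and negative outside of
    the closed ball, where \<open>flat_fun 0\<close> vanishes.\<close>
  define q where "q y = r\<^sup>2 + (-1) *\<^sub>R (\<Sum>i\<in>Basis. ((y + - c) \<bullet> i) *\<^sub>R ((y + - c) \<bullet> i))" for y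
  let ?b = "\<lambda>y. flat_fun 0 (q y)"
  have q: "q y = r\<^sup>2 - (norm (y - c))\<^sup>2" for y
    by (simp add: q_def power2_norm_eq_inner euclidean_inner[of "y - c" "y - c"])
  have "times_differentiable_on k UNIV q" for k
    unfolding q_def
    by (intro times_differentiable_on_add times_differentiable_on_sum
          times_differentiable_on_scaleR times_differentiable_on_id times_differentiable_on_const
          times_differentiable_on_bounded_linear[OF _ bounded_linear_inner_left]) auto
  then show "times_differentiable_on k UNIV ?b" for k
    by (intro times_differentiable_on_compose[where T = UNIV and f = "flat_fun 0" and g = q]
        times_differentiable_on_flat_fun) auto
  show "?b y \<ge> 0" for y
    by (simp add: flat_fun_def)
  show "?b c > 0"
    using assms by (simp add: q flat_fun_def)
  show "?b y = 0" if "y \<notin> cball c r" for y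
  proof -
    have "r < norm (y - c)"
      using that by (simp add: dist_norm norm_minus_commute)
    then have "r\<^sup>2 < (norm (y - c))\<^sup>2"
      using assms by (intro power_strict_mono) auto
    then show ?thesis
      by (simp add: q flat_fun_def)
  qed
qed

lemma dir_derivs_scaleR:
  assumes "open S" "smooth_on S f" "y \<in> S"
  shows "dir_derivs (\<lambda>x. c *\<^sub>R f x) vs y = c *\<^sub>R dir_derivs f vs y"
  using assms(3)
proof (induction vs arbitrary: y)
  case (Cons v vs)
  have d: "dir_derivs f vs differentiable (at y)"
    using assms(2) Cons.prems by (simp add: smooth_on_def)
  then have "((\<lambda>x. c *\<^sub>R dir_derivs f vs x) has_derivative
      (\<lambda>v. c *\<^sub>R frechet_derivative (dir_derivs f vs) (at y) v)) (at y)"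
    using frechet_derivative_works by (intro has_derivative_scaleR_right) blast
  then have "(dir_derivs (\<lambda>x. c *\<^sub>R f x) vs has_derivative
      (\<lambda>v. c *\<^sub>R frechet_derivative (dir_derivs f vs) (at y) v)) (at y)"
    by (rule has_derivative_transform_within_open[OF _ assms(1) Cons.prems]) (simp add: Cons.IH)
  from frechet_derivative_at[OF this] show ?case
    by (simp add: fun_eq_iff)
qed simp

section \<open>Smooth functions on a compact manifold\<close>

lemma mem_Cinf_iff:
  "f \<in> Cinf X A \<longleftrightarrow> continuous_map X euclideanreal f \<and> (\<forall>x. x \<notin> topspace X \<longrightarrow> f x = 0) \<and>
     (\<forall>(U, \<phi>)\<in>A. smooth_on (\<phi> ` U) (\<lambda>y. f (inv_into U \<phi> y)))"
  by (auto simp: Cinf_def smooth_map_def euclidean_atlas_def comp_def)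

locale compact_manifold =
  fixes X :: "'a topology" and A :: "('a, 'e::euclidean_space) chart set"
  assumes manifold: "smooth_manifold X A" and compact: "compact_space X"
begin

section \<open>Charts as homeomorphisms onto open sets\<close>

lemma Hausdorff: "Hausdorff_space X"
  using manifold by (simp add: smooth_manifold_def)

lemma chart_at:
  assumes "x \<in> topspace X"
  obtains U \<phi> where "(U, \<phi>) \<in> A" "x \<in> U"
proof -
  have "(\<Union>(U, \<phi>)\<in>A. U) = topspace X"
    using manifold unfolding smooth_manifold_def by blast
  then have "x \<in> (\<Union>(U, \<phi>)\<in>A. U)"
    using assms by simp
  then show ?thesis
    using that by auto
qed

lemma chart:
  assumes "(U, \<phi>) \<in> A"
  shows chart_domain_open: "openin X U"
    and chart_image_open: "open (\<phi> ` U)"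
    and chart_homeomorphic: "homeomorphic_map (subtopology X U) (top_of_set (\<phi> ` U)) \<phi>"
  using manifold assms by (auto simp: smooth_manifold_def)

lemma chart_domain_subset: "(U, \<phi>) \<in> A \<Longrightarrow> U \<subseteq> topspace X"
  using chart_domain_open openin_subset by blast

lemma chart_inj: "(U, \<phi>) \<in> A \<Longrightarrow> inj_on \<phi> U"
  using chart_homeomorphic[of U \<phi>] chart_domain_subset[of U \<phi>]
  by (simp add: homeomorphic_map_def Int_absorb1)

lemma chart_transition_smooth:
  assumes "(U, \<phi>) \<in> A" "(V, \<psi>) \<in> A"
  shows "smooth_on (\<phi> ` (U \<inter> V)) (\<lambda>y. \<psi> (inv_into U \<phi> y))"
proof -
  have "\<forall>(U, \<phi>)\<in>A. \<forall>(V, \<psi>)\<in>A. smooth_on (\<phi> ` (U \<inter> V)) (\<psi> \<circ> inv_into U \<phi>)"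
    using manifold unfolding smooth_manifold_def by (elim conjE)
  from bspec[OF bspec[OF this assms(1), simplified] assms(2)] show ?thesis
    by (simp add: comp_def)
qed

lemma chart_open_image:
  assumes "(U, \<phi>) \<in> A" "openin X W" "W \<subseteq> U"
  shows "open (\<phi> ` W)"
proof -
  have "openin (top_of_set (\<phi> ` U)) (\<phi> ` W)"
    using homeomorphic_imp_open_map[OF chart_homeomorphic[OF assms(1)]] assms(2,3)
    by (simp add: open_map_def openin_open_subtopology chart_domain_open[OF assms(1)])
  then show ?thesis
    using chart_image_open[OF assms(1)] openin_open_trans by blast
qed

lemma chart_open_vimage:
  assumes "(U, \<phi>) \<in> A" "open B"
  shows "openin X {x \<in> U. \<phi> x \<in> B}"
proof -
  have "openin (subtopology X U) {x \<in> topspace (subtopology X U). \<phi> x \<in> \<phi> ` U \<inter> B}"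
    by (rule openin_continuous_map_preimage[OF
          homeomorphic_imp_continuous_map[OF chart_homeomorphic[OF assms(1)]]])
       (use assms(2) openin_open in blast)
  moreover have "{x \<in> topspace (subtopology X U). \<phi> x \<in> \<phi> ` U \<inter> B} = {x \<in> U. \<phi> x \<in> B}"
    using chart_domain_subset[OF assms(1)] by auto
  ultimately show ?thesis
    using chart_domain_open[OF assms(1)] by (simp add: openin_open_subtopology)
qed

text \<open>The set is the image of \<open>K\<close> under the inverse chart, hence compact, hence
  closed in all of the Hausdorff space \<open>X\<close> and not merely in \<open>U\<close>.\<close>

lemma chart_closed_vimage:
  assumes UA: "(U, \<phi>) \<in> A" and "compact K" "K \<subseteq> \<phi> ` U"
  shows "closedin X {x \<in> U. \<phi> x \<in> K}"
proof -
  obtain g where g: "homeomorphic_maps (subtopology X U) (top_of_set (\<phi> ` U)) \<phi> g"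
    using chart_homeomorphic[OF UA] homeomorphic_map_maps by blast
  have "compactin (top_of_set (\<phi> ` U)) K"
    using assms by (simp add: compactin_subtopology)
  then have "compactin (subtopology X U) (g ` K)"
    using g image_compactin by (metis homeomorphic_maps_def)
  moreover have "g ` K = {x \<in> U. \<phi> x \<in> K}"
    using g assms(3) chart_domain_subset[OF UA] unfolding homeomorphic_maps_def image_def
    by (auto simp: Int_absorb1) (metis imageE subsetD)+
  ultimately have "compactin X {x \<in> U. \<phi> x \<in> K}"
    by (simp add: compactin_subtopology)
  then show ?thesis
    using Hausdorff compactin_imp_closedin by blast
qed

text \<open>Continuity in a chart is the case of the empty list of directions; the chart domains are
  open, so the local statements paste together.\<close>

lemma smooth_imp_continuous_map:
  fixes f :: "'a \<Rightarrow> real"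
  assumes "\<And>U \<phi>. (U, \<phi>) \<in> A \<Longrightarrow> smooth_on (\<phi> ` U) (\<lambda>y. f (inv_into U \<phi> y))"
  shows "continuous_map X euclideanreal f"
proof (rule pasting_lemma[where I = A and T = fst and f = "\<lambda>_. f"])
  fix i assume "i \<in> A"
  then obtain U \<phi> where i: "i = (U, \<phi>)" and UA: "(U, \<phi>) \<in> A"
    by (cases i) auto
  show "openin X (fst i)"
    using chart_domain_open[OF UA] i by simp
  have "continuous_on (\<phi> ` U) (dir_derivs (\<lambda>y. f (inv_into U \<phi> y)) [])"
    using assms[OF UA] unfolding smooth_on_def by blast
  then have "continuous_map (subtopology X U) euclideanreal ((\<lambda>y. f (inv_into U \<phi> y)) \<circ> \<phi>)"
    by (intro continuous_map_compose[OF
          homeomorphic_imp_continuous_map[OF chart_homeomorphic[OF UA]]]) simp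
  then have "continuous_map (subtopology X U) euclideanreal f"
    by (rule continuous_map_eq) (use chart_inj[OF UA] in auto)
  then show "continuous_map (subtopology X (fst i)) euclideanreal f"
    using i by simp
next
  fix x assume "x \<in> topspace X"
  then show "\<exists>j. j \<in> A \<and> x \<in> fst j \<and> f x = f x"
    using chart_at by (metis fst_conv)
qed simp

section \<open>The vector space of smooth functions and its bump functions\<close>

lemma CinfI:
  assumes "\<And>x. x \<notin> topspace X \<Longrightarrow> f x = 0"
    "\<And>U \<phi> k. (U, \<phi>) \<in> A \<Longrightarrow> times_differentiable_on k (\<phi> ` U) (\<lambda>y. f (inv_into U \<phi> y))"
  shows "f \<in> Cinf X A"
  using assms smooth_imp_continuous_map by (auto simp: mem_Cinf_iff smooth_on_iff)

lemma Cinf_chart: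
  "f \<in> Cinf X A \<Longrightarrow> (U, \<phi>) \<in> A \<Longrightarrow> times_differentiable_on k (\<phi> ` U) (\<lambda>y. f (inv_into U \<phi> y))"
  by (auto simp: mem_Cinf_iff smooth_on_iff)

lemma Cinf_continuous: "f \<in> Cinf X A \<Longrightarrow> continuous_map X euclideanreal f"
  by (simp add: mem_Cinf_iff)

lemma Cinf_outside: "f \<in> Cinf X A \<Longrightarrow> x \<notin> topspace X \<Longrightarrow> f x = 0"
  by (simp add: mem_Cinf_iff)

lemma Cinf_add: "f \<in> Cinf X A \<Longrightarrow> g \<in> Cinf X A \<Longrightarrow> f + g \<in> Cinf X A"
  by (rule CinfI)
     (simp_all add: Cinf_outside times_differentiable_on_add Cinf_chart chart_image_open)

lemma Cinf_scaleR: "f \<in> Cinf X A \<Longrightarrow> c *\<^sub>R f \<in> Cinf X A"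
  by (rule CinfI)
     (simp_all add: Cinf_outside scaleR_fun_def Cinf_chart chart_image_open
       times_differentiable_on_bounded_linear[OF _ bounded_linear_mult_right])

lemma Cinf_zero: "0 \<in> Cinf X A"
  by (intro CinfI) (auto intro: times_differentiable_on_const chart_image_open)

lemma Cinf_sum: "(\<And>i. i \<in> I \<Longrightarrow> f i \<in> Cinf X A) \<Longrightarrow> (\<Sum>i\<in>I. f i) \<in> Cinf X A"
  by (induction I rule: infinite_finite_induct) (auto simp: Cinf_zero Cinf_add)

lemma Cinf_bounded:
  assumes "f \<in> Cinf X A"
  obtains B where "\<And>x. x \<in> topspace X \<Longrightarrow> \<bar>f x\<bar> \<le> B"
proof -
  have "compactin euclideanreal (f ` topspace X)"
    using image_compactin[OF _ Cinf_continuous[OF assms]] compact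
    by (simp add: compact_space_def)
  then have "bounded (f ` topspace X)"
    by (simp add: compact_imp_bounded)
  then show ?thesis
    using that by (auto simp: bounded_iff)
qed

text \<open>A Euclidean bump is pulled back along one chart and extended by zero. The extension is
  smooth because the preimage \<open>C\<close> of the closed ball, outside of which it vanishes, is
  closed in \<open>X\<close>.\<close>

lemma Cinf_bump:
  assumes "openin X W" "p \<in> W"
  obtains g where "g \<in> Cinf X A" "\<And>x. g x \<ge> 0" "g p > 0" "\<And>x. x \<notin> W \<Longrightarrow> g x = 0"
proof -
  have "p \<in> topspace X"
    using assms openin_subset by blast
  then obtain U \<phi> where UA: "(U, \<phi>) \<in> A" and pU: "p \<in> U"
    by (rule chart_at)
  have "open (\<phi> ` (W \<inter> U))"
    by (rule chart_open_image[OF UA openin_Int[OF assms(1) chart_domain_open[OF UA]]]) simp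
  then obtain r where r: "r > 0" "cball (\<phi> p) r \<subseteq> \<phi> ` (W \<inter> U)"
    using assms(2) pU unfolding open_contains_cball by blast
  obtain b :: "'e \<Rightarrow> real" where b: "\<And>k. times_differentiable_on k UNIV b" "\<And>y. b y \<ge> 0"
    "b (\<phi> p) > 0" "\<And>y. y \<notin> cball (\<phi> p) r \<Longrightarrow> b y = 0"
    using smooth_ball_bump[OF r(1)] by blast
  define g where "g x = (if x \<in> U then b (\<phi> x) else 0)" for x
  define C where "C = {x \<in> U. \<phi> x \<in> cball (\<phi> p) r}"
  have "closedin X C"
    unfolding C_def by (rule chart_closed_vimage[OF UA]) (use r in auto)
  have C: "C \<subseteq> W"
    using r(2) chart_inj[OF UA] unfolding C_def inj_on_def by blast
  have g0: "g x = 0" if "x \<notin> C" for x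
    using that b(4) by (auto simp: g_def C_def)
  show ?thesis
  proof
    show "g \<in> Cinf X A"
    proof (rule CinfI)
      fix V \<psi> k assume VA: "(V, \<psi>) \<in> A"
      show "times_differentiable_on k (\<psi> ` V) (\<lambda>y. g (inv_into V \<psi> y))"
      proof (rule times_differentiable_on_local)
        fix y assume "y \<in> \<psi> ` V"
        then obtain x where x: "x \<in> V" "y = \<psi> x"
          by auto
        show "\<exists>T. y \<in> T \<and> times_differentiable_on k T (\<lambda>y. g (inv_into V \<psi> y))"
        \<comment> \<open>The domain \<open>V\<close> is covered by the open sets
          \<open>V \<inter> U\<close>, where a transition map is composed with \<open>b\<close>, and
          \<open>V - C\<close>, where the function is zero.\<close>
        proof (cases "x \<in> U")
          case True
          let ?T = "\<psi> ` (V \<inter> U)"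
          have T: "open ?T"
            by (rule chart_open_image[OF VA openin_Int[OF
                  chart_domain_open[OF VA] chart_domain_open[OF UA]]]) simp
          have "times_differentiable_on k ?T (\<lambda>y. \<phi> (inv_into V \<psi> y))"
            using chart_transition_smooth[OF VA UA] by (simp add: smooth_on_iff)
          then have "times_differentiable_on k ?T (\<lambda>y. b (\<phi> (inv_into V \<psi> y)))"
            by (rule times_differentiable_on_compose[OF T subset_UNIV b(1)])
          then have "times_differentiable_on k ?T (\<lambda>y. g (inv_into V \<psi> y))"
            by (rule times_differentiable_on_cong[OF T, rotated])
               (use chart_inj[OF VA] in \<open>auto simp: g_def\<close>)
          then show ?thesis
            using True x by (intro exI[of _ ?T] conjI) auto
        next
          case False
          let ?T = "\<psi> ` (V - C)"
          have T: "open ?T"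
            by (rule chart_open_image[OF VA openin_diff[OF
                  chart_domain_open[OF VA] \<open>closedin X C\<close>]]) simp
          have "times_differentiable_on k ?T (\<lambda>y. g (inv_into V \<psi> y))"
            by (rule times_differentiable_on_cong[OF T _ times_differentiable_on_const[OF T, of _ 0]])
               (use chart_inj[OF VA] in \<open>auto simp: g0\<close>)
          then show ?thesis
            using False x by (intro exI[of _ ?T] conjI) (auto simp: C_def)
        qed
      qed
    qed (use chart_domain_subset[OF UA] in \<open>auto simp: g_def\<close>)
    show "g x \<ge> 0" for x
      using b(2) by (simp add: g_def)
    show "g p > 0"
      using b(3) pU by (simp add: g_def)
    show "g x = 0" if "x \<notin> W" for x
      using that C g0 by blast
  qed
qed

text \<open>By compactness finitely many nonnegative bumps, all vanishing on \<open>C2\<close>, have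
  positivity sets covering \<open>C1\<close>; their sum is the required function.\<close>

lemma Cinf_Urysohn:
  assumes C1: "closedin X C1" and C2: "closedin X C2" and "C1 \<inter> C2 = {}"
  obtains g where "g \<in> Cinf X A" "\<And>x. g x \<ge> 0" "\<And>x. x \<in> C1 \<Longrightarrow> g x > 0" "\<And>x. x \<in> C2 \<Longrightarrow> g x = 0"
proof -
  have sub: "C1 \<subseteq> topspace X"
    using C1 closedin_subset by blast
  have "\<exists>b. b \<in> Cinf X A \<and> (\<forall>x. b x \<ge> 0) \<and> b p > 0 \<and> (\<forall>x\<in>C2. b x = 0)" if "p \<in> C1" for p
  proof (rule Cinf_bump[of "topspace X - C2" p])
    show "openin X (topspace X - C2)"
      using C2 by (simp add: openin_diff)
    show "p \<in> topspace X - C2"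
      using that sub assms(3) by auto
  qed auto
  then obtain b where b: "\<And>p. p \<in> C1 \<Longrightarrow> b p \<in> Cinf X A \<and> (\<forall>x. b p x \<ge> 0) \<and> b p p > 0 \<and> (\<forall>x\<in>C2. b p x = 0)"
    by metis
  define O' where "O' p = {x \<in> topspace X. b p x \<in> {0<..}}" for p
  have "openin X (O' p)" if "p \<in> C1" for p
    unfolding O'_def using b[OF that]
    by (intro openin_continuous_map_preimage[OF Cinf_continuous]) auto
  moreover have "C1 \<subseteq> \<Union>(O' ` C1)"
    using b sub by (auto simp: O'_def)
  moreover have "compactin X C1"
    using C1 compact closedin_compact_space by blast
  ultimately obtain \<F> where "finite \<F>" "\<F> \<subseteq> O' ` C1" "C1 \<subseteq> \<Union>\<F>"
    using compactinD[of X C1 "O' ` C1"] by auto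
  then obtain D where D: "finite D" "D \<subseteq> C1" "C1 \<subseteq> \<Union>(O' ` D)"
    by (metis finite_subset_image)
  let ?g = "\<Sum>p\<in>D. b p"
  have g: "?g x = (\<Sum>p\<in>D. b p x)" for x
    by (induction D rule: infinite_finite_induct) auto
  show ?thesis
  proof
    show "?g \<in> Cinf X A"
      using D b by (intro Cinf_sum) auto
    show "?g x \<ge> 0" for x
      unfolding g using D b by (intro sum_nonneg) blast
    show "?g x > 0" if x: "x \<in> C1" for x
    proof -
      obtain p where "p \<in> D" "b p x > 0"
        using D(3) x by (auto simp: O'_def)
      then show ?thesis
        unfolding g using D b by (intro sum_pos2[OF D(1)]) blast+
    qed
    show "?g x = 0" if "x \<in> C2" for x
      unfolding g using D b that by (intro sum.neutral) blast
  qed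
qed

section \<open>The topology of uniform convergence of all derivatives\<close>

lemma topspace_Cinf_topology: "topspace (Cinf_topology X A) = Cinf X A"
  unfolding Cinf_topology_def topology_generated_by_topspace by auto

text \<open>The seminorms of order zero: the list of directions is empty.\<close>

lemma openin_Cinf_topology_chart_ball:
  assumes "f \<in> Cinf X A" "(U, \<phi>) \<in> A" "compact K" "K \<subseteq> \<phi> ` U" "\<epsilon> > 0"
  shows "openin (Cinf_topology X A) {g \<in> Cinf X A. \<forall>x\<in>U. \<phi> x \<in> K \<longrightarrow> \<bar>g x - f x\<bar> < \<epsilon>}"
proof -
  have "openin (Cinf_topology X A)
    {g \<in> Cinf X A. \<forall>y\<in>K. \<bar>dir_derivs (g \<circ> inv_into U \<phi>) [] y - dir_derivs (f \<circ> inv_into U \<phi>) [] y\<bar> < \<epsilon>}"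
    (is "openin _ ?S")
    unfolding Cinf_topology_def
    by (rule topology_generated_by_Basis) (use assms in blast)
  moreover have "?S = {g \<in> Cinf X A. \<forall>x\<in>U. \<phi> x \<in> K \<longrightarrow> \<bar>g x - f x\<bar> < \<epsilon>}"
    using assms(4) chart_inj[OF assms(2)] by (fastforce simp: subset_iff)
  ultimately show ?thesis
    by simp
qed

text \<open>Finitely many open sets, each inside a compact piece \<open>K x\<close> of a chart,
  cover the compact manifold; the ball is the intersection of the corresponding chart balls.\<close>

lemma openin_Cinf_topology_sup_ball:
  assumes "f \<in> Cinf X A" "\<epsilon> > 0"
  shows "openin (Cinf_topology X A) {g \<in> Cinf X A. \<forall>x\<in>topspace X. \<bar>g x - f x\<bar> < \<epsilon>}"
proof -
  have "\<forall>x\<in>topspace X. \<exists>q. case q of (B, U, \<phi>, K) \<Rightarrow>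
      openin X B \<and> x \<in> B \<and> (U, \<phi>) \<in> A \<and> compact K \<and> K \<subseteq> \<phi> ` U \<and> B \<subseteq> {y \<in> U. \<phi> y \<in> K}"
  proof
    fix x assume "x \<in> topspace X"
    obtain U \<phi> where UA: "(U, \<phi>) \<in> A" "x \<in> U"
      using chart_at \<open>x \<in> topspace X\<close> by blast
    then obtain r where r: "r > 0" "cball (\<phi> x) r \<subseteq> \<phi> ` U"
      using chart_image_open[of U \<phi>] unfolding open_contains_cball by blast
    have "openin X {y \<in> U. \<phi> y \<in> ball (\<phi> x) r}"
      by (rule chart_open_vimage[OF UA(1)]) simp
    moreover have "{y \<in> U. \<phi> y \<in> ball (\<phi> x) r} \<subseteq> {y \<in> U. \<phi> y \<in> cball (\<phi> x) r}"
      by auto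
    moreover have "x \<in> {y \<in> U. \<phi> y \<in> ball (\<phi> x) r}"
      using UA r by simp
    ultimately show "\<exists>q. case q of (B, U, \<phi>, K) \<Rightarrow>
      openin X B \<and> x \<in> B \<and> (U, \<phi>) \<in> A \<and> compact K \<and> K \<subseteq> \<phi> ` U \<and> B \<subseteq> {y \<in> U. \<phi> y \<in> K}"
      using UA(1) r(2)
      by (intro exI[of _ "({y \<in> U. \<phi> y \<in> ball (\<phi> x) r}, U, \<phi>, cball (\<phi> x) r)"]) simp
  qed
  from bchoice[OF this] obtain q where q: "\<forall>x\<in>topspace X. case q x of (B, U, \<phi>, K) \<Rightarrow>
      openin X B \<and> x \<in> B \<and> (U, \<phi>) \<in> A \<and> compact K \<and> K \<subseteq> \<phi> ` U \<and> B \<subseteq> {y \<in> U. \<phi> y \<in> K}" ..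
  define B where "B x = fst (q x)" for x
  define U where "U x = fst (snd (q x))" for x
  define \<phi> where "\<phi> x = fst (snd (snd (q x)))" for x
  define K where "K x = snd (snd (snd (q x)))" for x
  have B: "openin X (B x) \<and> x \<in> B x \<and> (U x, \<phi> x) \<in> A \<and> compact (K x) \<and> K x \<subseteq> \<phi> x ` U x \<and>
      B x \<subseteq> {y \<in> U x. \<phi> x y \<in> K x}" if "x \<in> topspace X" for x
    using bspec[OF q that] by (simp add: B_def U_def \<phi>_def K_def case_prod_unfold)
  have "topspace X \<subseteq> \<Union>(B ` topspace X)"
    using B by blast
  then obtain \<F> where "finite \<F>" "\<F> \<subseteq> B ` topspace X" "topspace X \<subseteq> \<Union>\<F>"
    using compactinD[of X "topspace X" "B ` topspace X"] B compact
    by (auto simp: compact_space_def)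
  then obtain D where D: "finite D" "D \<subseteq> topspace X" "topspace X \<subseteq> \<Union>(B ` D)"
    by (metis finite_subset_image)
  let ?N = "\<lambda>x. {g \<in> Cinf X A. \<forall>y\<in>U x. \<phi> x y \<in> K x \<longrightarrow> \<bar>g y - f y\<bar> < \<epsilon>}"
  have "openin (Cinf_topology X A) (?N x)" if "x \<in> D" for x
    using B[of x] D(2) that assms by (intro openin_Cinf_topology_chart_ball) auto
  \<comment> \<open>The factor \<open>Cinf X A\<close> gives the intersection its meaning when
    \<open>D\<close> is empty, that is, for the empty manifold.\<close>
  then have "openin (Cinf_topology X A) (Cinf X A \<inter> (\<Inter>x\<in>D. ?N x))"
    using D(1) openin_topspace[of "Cinf_topology X A"]
    by (cases "D = {}") (auto simp: topspace_Cinf_topology intro!: openin_Int openin_Inter)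
  moreover have "Cinf X A \<inter> (\<Inter>x\<in>D. ?N x) = {g \<in> Cinf X A. \<forall>x\<in>topspace X. \<bar>g x - f x\<bar> < \<epsilon>}"
  proof (intro subset_antisym subsetI)
    fix g assume g: "g \<in> Cinf X A \<inter> (\<Inter>x\<in>D. ?N x)"
    have "\<bar>g y - f y\<bar> < \<epsilon>" if "y \<in> topspace X" for y
    proof -
      have "y \<in> \<Union>(B ` D)"
        using D(3) that by (rule subsetD)
      then obtain x where x: "x \<in> D" "y \<in> B x"
        by (rule UN_E)
      have "B x \<subseteq> {y \<in> U x. \<phi> x y \<in> K x}"
        using B[OF subsetD[OF D(2) x(1)]] by (elim conjE)
      then have "y \<in> U x" "\<phi> x y \<in> K x"
        using x(2) by auto
      moreover have "g \<in> ?N x"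
        using g x(1) by simp
      ultimately show ?thesis
        by simp
    qed
    then show "g \<in> {g \<in> Cinf X A. \<forall>x\<in>topspace X. \<bar>g x - f x\<bar> < \<epsilon>}"
      using g by simp
  next
    fix g assume g: "g \<in> {g \<in> Cinf X A. \<forall>x\<in>topspace X. \<bar>g x - f x\<bar> < \<epsilon>}"
    have "g \<in> ?N x" if "x \<in> D" for x
      using g B[OF subsetD[OF D(2) that]] chart_domain_subset[of "U x" "\<phi> x"] by auto
    then show "g \<in> Cinf X A \<inter> (\<Inter>x\<in>D. ?N x)"
      using g by simp
  qed
  ultimately show ?thesis
    by simp
qed

lemma Cinf_topology_tendsto_at:
  assumes "limitin (Cinf_topology X A) h f F" "x \<in> topspace X"
  shows "((\<lambda>i. h i x) \<longlongrightarrow> f x) F"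
proof (rule tendstoI)
  fix \<epsilon> :: real assume "\<epsilon> > 0"
  have f: "f \<in> Cinf X A"
    using assms(1) by (simp add: limitin_def topspace_Cinf_topology)
  then have "f \<in> {g \<in> Cinf X A. \<forall>x\<in>topspace X. \<bar>g x - f x\<bar> < \<epsilon>}"
    using \<open>\<epsilon> > 0\<close> by simp
  with openin_Cinf_topology_sup_ball[OF f \<open>\<epsilon> > 0\<close>]
  have "\<forall>\<^sub>F i in F. h i \<in> {g \<in> Cinf X A. \<forall>x\<in>topspace X. \<bar>g x - f x\<bar> < \<epsilon>}"
    by (intro assms(1)[unfolded limitin_def, THEN conjunct2, THEN spec, THEN mp] conjI)
  then show "\<forall>\<^sub>F i in F. dist (h i x) (f x) < \<epsilon>"
    by eventually_elim (use assms(2) in \<open>auto simp: dist_real_def\<close>)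
qed

text \<open>Allows a given smooth function to be scaled into the neighbourhood on which the
  exponential function has an inverse. The induction follows the generation of open sets from the
  subbasis.\<close>

lemma Cinf_neighbourhood_absorbs:
  assumes "openin (Cinf_topology X A) W" "0 \<in> W" "f \<in> Cinf X A"
  shows "\<forall>\<^sub>F c in at_right 0. c *\<^sub>R f \<in> W"
  using openin_topology_generated_by[OF assms(1)[unfolded Cinf_topology_def]] assms(2)
proof (induction rule: generate_topology_on.induct)
  case (Int a b)
  then show ?case
    by (simp add: eventually_conj_iff)
next
  case (UN \<K>)
  then obtain k where k: "k \<in> \<K>" "0 \<in> k"
    by blast
  from UN.IH[OF k] show ?case
    by eventually_elim (use k in blast)
next
  case (Basis S)
  then consider "S = Cinf X A" | f0 U \<phi> K vs \<epsilon> where "S = {g \<in> Cinf X A. \<forall>y\<in>K.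
      \<bar>dir_derivs (g \<circ> inv_into U \<phi>) vs y - dir_derivs (f0 \<circ> inv_into U \<phi>) vs y\<bar> < \<epsilon>}"
    "f0 \<in> Cinf X A" "(U, \<phi>) \<in> A" "compact K" "K \<subseteq> \<phi> ` U" "\<epsilon> > 0"
    by blast
  then show ?case
  proof cases
    case 1
    then show ?thesis
      using Cinf_scaleR[OF assms(3)] by simp
  next
    case 2
    define D where "D = dir_derivs (f \<circ> inv_into U \<phi>) vs"
    define D0 where "D0 = dir_derivs (f0 \<circ> inv_into U \<phi>) vs"
    have sm: "smooth_on (\<phi> ` U) (g \<circ> inv_into U \<phi>)" if "g \<in> Cinf X A" for g
      using Cinf_chart[OF that 2(3)] by (simp add: smooth_on_iff comp_def)
    have scale: "dir_derivs ((c *\<^sub>R f) \<circ> inv_into U \<phi>) vs y = c * D y" if "y \<in> K" for c y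
      using dir_derivs_scaleR[OF chart_image_open[OF 2(3)] sm[OF assms(3)], of y c vs] that 2(5)
      by (auto simp: D_def comp_def scaleR_fun_def)
    \<comment> \<open>This is the membership of \<open>0\<close> in the subbasic set
      \<open>S\<close>.\<close>
    have small: "\<bar>D0 y\<bar> < \<epsilon>" if "y \<in> K" for y
    proof -
      have "dir_derivs ((0 :: 'a \<Rightarrow> real) \<circ> inv_into U \<phi>) vs y = 0"
        using scale[OF that, of 0] by simp
      moreover have "\<bar>dir_derivs ((0 :: 'a \<Rightarrow> real) \<circ> inv_into U \<phi>) vs y - D0 y\<bar> < \<epsilon>"
        using Basis(2) that unfolding 2(1) D0_def by blast
      ultimately show ?thesis
        by simp
    qed
    have cont: "continuous_on K D" "continuous_on K D0"
      unfolding D_def D0_def using sm[OF assms(3)] sm[OF 2(2)] 2(5)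
      by (auto simp: smooth_on_def intro: continuous_on_subset)
    have "\<forall>\<^sub>F c in at_right 0. \<forall>y\<in>K. \<bar>c * D y - D0 y\<bar> < \<epsilon>"
    proof (cases "K = {}")
      case False
      \<comment> \<open>The strict bound on \<open>D0\<close> is attained at worst at
        \<open>y0\<close>, so a margin \<open>\<epsilon> - \<bar>D0 y0\<bar>\<close> uniform in
        \<open>y\<close> is left for \<open>c * D y\<close>.\<close>
      obtain y0 where y0: "y0 \<in> K" "\<And>y. y \<in> K \<Longrightarrow> \<bar>D0 y\<bar> \<le> \<bar>D0 y0\<bar>"
        using continuous_attains_sup[OF 2(4) False, of "\<lambda>y. \<bar>D0 y\<bar>"] cont(2)
        by (auto intro: continuous_intros)
      obtain B where B: "B > 0" "\<And>y. y \<in> K \<Longrightarrow> \<bar>D y\<bar> \<le> B"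
        using compact_imp_bounded[OF compact_continuous_image[OF cont(1) 2(4)]]
        by (auto simp: bounded_pos)
      have "\<bar>c * D y - D0 y\<bar> < \<epsilon>" if "0 < c" "c < (\<epsilon> - \<bar>D0 y0\<bar>) / B" "y \<in> K" for c y
      proof -
        have "\<bar>c * D y - D0 y\<bar> \<le> \<bar>c * D y\<bar> + \<bar>D0 y\<bar>"
          by linarith
        also have "\<dots> \<le> c * B + \<bar>D0 y0\<bar>"
          using that B(2) y0(2) by (intro add_mono) (auto simp: abs_mult intro: mult_left_mono)
        also have "\<dots> < \<epsilon>"
          using that B(1) by (simp add: field_simps)
        finally show ?thesis .
      qed
      then show ?thesis
        unfolding eventually_at_right_field
        using small[OF y0(1)] B(1) by (intro exI[of _ "(\<epsilon> - \<bar>D0 y0\<bar>) / B"]) auto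
    qed simp
    then show ?thesis
      by eventually_elim (use 2(1) Cinf_scaleR[OF assms(3)] scale in \<open>auto simp: D0_def\<close>)
  qed
qed simp

end

section \<open>Continuous flows\<close>

locale continuous_flow =
  fixes X :: "'a topology" and \<sigma> :: "real \<Rightarrow> 'a \<Rightarrow> 'a"
  assumes flow_continuous: "continuous_map (prod_topology euclideanreal X) X (\<lambda>(t, x). \<sigma> t x)"
    and flow_zero: "x \<in> topspace X \<Longrightarrow> \<sigma> 0 x = x"
    and flow_add: "x \<in> topspace X \<Longrightarrow> \<sigma> (s + t) x = \<sigma> s (\<sigma> t x)"
begin

lemma continuous_map_flow: "continuous_map X X (\<sigma> t)"
proof -
  have "continuous_map X X ((\<lambda>(t, x). \<sigma> t x) \<circ> (\<lambda>x. (t, x)))"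
    by (rule continuous_map_compose[OF _ flow_continuous])
       (auto simp: continuous_map_pairwise comp_def)
  then show ?thesis
    by (simp add: comp_def)
qed

lemma continuous_map_orbit:
  assumes "x \<in> topspace X"
  shows "continuous_map euclideanreal X (\<lambda>t. \<sigma> t x)"
proof -
  have "continuous_map euclideanreal X ((\<lambda>(t, x). \<sigma> t x) \<circ> (\<lambda>t. (t, x)))"
    by (rule continuous_map_compose[OF _ flow_continuous])
       (use assms in \<open>auto simp: continuous_map_pairwise comp_def\<close>)
  then show ?thesis
    by (simp add: comp_def)
qed

lemma flow_in_topspace: "x \<in> topspace X \<Longrightarrow> \<sigma> t x \<in> topspace X"
  using continuous_map_image_subset_topspace[OF continuous_map_flow] by blast

end

lemma smooth_flow_imp_continuous_flow: "smooth_flow X A \<sigma> \<Longrightarrow> continuous_flow X \<sigma>"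
  by (simp add: smooth_flow_def smooth_map_def continuous_flow_def)

section \<open>The exponential function of the group of a flow\<close>

locale compact_flow = compact_manifold X A + continuous_flow X \<sigma>
  for X :: "'a topology" and A :: "('a, 'e::euclidean_space) chart set"
    and \<sigma> :: "real \<Rightarrow> 'a \<Rightarrow> 'a"
begin

lemma continuous_on_Cinf_orbit:
  assumes "f \<in> Cinf X A" "x \<in> topspace X"
  shows "continuous_on S (\<lambda>t. f (\<sigma> t x))"
proof -
  have "continuous_map euclideanreal euclideanreal (f \<circ> (\<lambda>t. \<sigma> t x))"
    by (rule continuous_map_compose[OF continuous_map_orbit[OF assms(2)] Cinf_continuous[OF assms(1)]])
  then show ?thesis
    by (auto simp: comp_def intro: continuous_on_subset)
qed

lemma topspace_flow_group_topology: "topspace (flow_group_topology X A) = Cinf X A \<times> UNIV"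
  by (simp add: flow_group_topology_def topspace_Cinf_topology)

context
  fixes ex and f :: "'a \<Rightarrow> real" and t :: real
  assumes ex: "exponential_function (flow_group_topology X A) (flow_group X A \<sigma>) ex"
    and f: "f \<in> Cinf X A"
begin

text \<open>The semidirect product law, by components: the first is a cocycle for the flow action,
  the second an additive function of time.\<close>

lemma one_parameter_add:
  "fst (ex ((s + r) *\<^sub>R (f, t))) = fst (ex (s *\<^sub>R (f, t)))
     + flow_action X \<sigma> (snd (ex (s *\<^sub>R (f, t)))) (fst (ex (r *\<^sub>R (f, t))))"
  "snd (ex ((s + r) *\<^sub>R (f, t))) = snd (ex (s *\<^sub>R (f, t))) + snd (ex (r *\<^sub>R (f, t)))"
proof -
  have "(f, t) \<in> topspace (flow_group_topology X A)"
    using f by (simp add: topspace_flow_group_topology)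
  then have "ex ((s + r) *\<^sub>R (f, t))
      = ex (s *\<^sub>R (f, t)) \<otimes>\<^bsub>flow_group X A \<sigma>\<^esub> ex (r *\<^sub>R (f, t))"
    using ex unfolding exponential_function_def by blast
  then show "fst (ex ((s + r) *\<^sub>R (f, t))) = fst (ex (s *\<^sub>R (f, t)))
     + flow_action X \<sigma> (snd (ex (s *\<^sub>R (f, t)))) (fst (ex (r *\<^sub>R (f, t))))"
    "snd (ex ((s + r) *\<^sub>R (f, t))) = snd (ex (s *\<^sub>R (f, t))) + snd (ex (r *\<^sub>R (f, t)))"
    by (simp_all add: flow_group_def case_prod_unfold del: scaleR_Pair)
qed

lemma one_parameter_zero: "ex (0 *\<^sub>R (f, t)) = (0, 0)"
proof -
  have "ex 0 = \<one>\<^bsub>flow_group X A \<sigma>\<^esub>"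
    using ex unfolding exponential_function_def by blast
  then show ?thesis
    by (simp add: flow_group_def del: scaleR_Pair)
qed

text \<open>The derivative at time 0 splits over the product topology, and convergence in
  \<open>Cinf_topology\<close> can be evaluated at a point.\<close>

lemma one_parameter_tendsto:
  "((\<lambda>h. snd (ex (h *\<^sub>R (f, t))) / h) \<longlongrightarrow> t) (at 0)"
  "y \<in> topspace X \<Longrightarrow> ((\<lambda>h. fst (ex (h *\<^sub>R (f, t))) y / h) \<longlongrightarrow> f y) (at 0)"
proof -
  have "(f, t) \<in> topspace (flow_group_topology X A)"
    using f by (simp add: topspace_flow_group_topology)
  then have "has_dir_deriv (flow_group_topology X A) (\<lambda>h. ex (h *\<^sub>R (f, t))) 0 (1::real) (f, t)"
    using ex unfolding exponential_function_def by blast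
  then have *: "limitin (Cinf_topology X A) (\<lambda>h. (1 / h) *\<^sub>R fst (ex (h *\<^sub>R (f, t)))) f (at 0)"
    "limitin euclideanreal (\<lambda>h. (1 / h) *\<^sub>R snd (ex (h *\<^sub>R (f, t)))) t (at 0)"
    unfolding has_dir_deriv_def one_parameter_zero flow_group_topology_def limitin_pairwise comp_def
    by (simp_all del: scaleR_Pair)
  show "((\<lambda>h. snd (ex (h *\<^sub>R (f, t))) / h) \<longlongrightarrow> t) (at 0)"
    using *(2) by simp
  show "((\<lambda>h. fst (ex (h *\<^sub>R (f, t))) y / h) \<longlongrightarrow> f y) (at 0)" if "y \<in> topspace X"
    using Cinf_topology_tendsto_at[OF *(1) that] by (simp add: scaleR_fun_def)
qed

text \<open>By additivity the derivative \<open>t\<close> at 0 is the derivative at every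
  time.\<close>

lemma snd_one_parameter: "snd (ex (s *\<^sub>R (f, t))) = s * t"
proof -
  define \<tau> where "\<tau> s = snd (ex (s *\<^sub>R (f, t)))" for s
  have "(\<tau> has_field_derivative t) (at r)" for r
    using one_parameter_tendsto(1) by (simp add: DERIV_def \<tau>_def one_parameter_add del: scaleR_Pair)
  then have "((\<lambda>r. \<tau> r - r * t) has_field_derivative 0) (at r)" for r
    by (auto intro!: derivative_eq_intros)
  then have "\<tau> s - s * t = \<tau> 0 - 0 * t"
    using DERIV_isconst_all by blast
  moreover have "\<tau> 0 = 0"
    unfolding \<tau>_def one_parameter_zero by simp
  ultimately show ?thesis
    by (simp add: \<tau>_def)
qed

lemma snd_exponential: "snd (ex (f, t)) = t"
  using snd_one_parameter[of 1] by simp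

text \<open>This is the formula \<open>exp (f, t) = (\<beta>\<^sub>t f, t)\<close>.\<close>

lemma fst_exponential:
  assumes "t > 0" "x \<in> topspace X"
  shows "((\<lambda>s. f (\<sigma> s x)) has_integral t * fst (ex (f, t)) x) {0..t}"
proof -
  define F where "F s = fst (ex (s *\<^sub>R (f, t))) x" for s
  \<comment> \<open>The cocycle identity turns an increment at time \<open>s\<close> into one at
    time 0, based at the moved point \<open>\<sigma> (s * t) x\<close>.\<close>
  have add: "F (s + h) - F s = fst (ex (h *\<^sub>R (f, t))) (\<sigma> (s * t) x)" for s h
    using assms(2) by (simp add: F_def one_parameter_add snd_one_parameter flow_action_def del: scaleR_Pair)
  have F: "(F has_field_derivative f (\<sigma> (s * t) x)) (at s)" for s
    unfolding DERIV_def add using one_parameter_tendsto(2) flow_in_topspace[OF assms(2)] by blast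
  \<comment> \<open>Rescaling the parameter interval [0,1] to [0,t] makes this a primitive of
    \<open>f\<close> along the orbit.\<close>
  have "((\<lambda>s. t * F (s / t)) has_field_derivative f (\<sigma> s x)) (at s)" for s
  proof -
    have "((\<lambda>s. F (s / t)) has_field_derivative f (\<sigma> (s / t * t) x) * (1 / t)) (at s)"
      by (rule DERIV_chain'[OF _ F]) (use \<open>t > 0\<close> in \<open>auto intro!: derivative_eq_intros\<close>)
    then have "((\<lambda>s. t * F (s / t)) has_field_derivative t * (f (\<sigma> (s / t * t) x) * (1 / t))) (at s)"
      by (rule DERIV_cmult)
    then show ?thesis
      using \<open>t > 0\<close> by simp
  qed
  then have "((\<lambda>s. f (\<sigma> s x)) has_integral t * F (t / t) - t * F (0 / t)) {0..t}"
    using assms(1)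
    by (intro fundamental_theorem_of_calculus)
       (auto simp: has_real_derivative_iff_has_vector_derivative[symmetric]
         intro: has_field_derivative_at_within)
  moreover have "F 0 = 0"
    unfolding F_def one_parameter_zero by simp
  ultimately show ?thesis
    using \<open>t > 0\<close> by (simp add: F_def)
qed

end

text \<open>Here \<open>F t\<close> is \<open>\<beta>\<^sub>t\<^sup>-\<^sup>1 g\<close>.\<close>

lemma locally_exponential_imp_beta_inverse:
  assumes "locally_exponential (flow_group_topology X A) (flow_group X A \<sigma>)"
  obtains \<epsilon> where "\<epsilon> > 0"
    "\<And>g. g \<in> Cinf X A \<Longrightarrow> \<exists>F. (\<forall>t\<in>{0<..<\<epsilon>}. F t \<in> Cinf X A \<and>
        (\<forall>x\<in>topspace X. ((\<lambda>s. F t (\<sigma> s x)) has_integral t * g x) {0..t}) \<and>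
        (\<forall>\<eta>>0. \<forall>\<^sub>F t' in at t. \<forall>x\<in>topspace X. \<bar>F t' x - F t x\<bar> < \<eta>))"
proof -
  let ?E = "flow_group_topology X A"
  obtain ex U V where ex: "exponential_function ?E (flow_group X A \<sigma>) ex"
    and U: "openin ?E U" and V: "openin ?E V" "\<one>\<^bsub>flow_group X A \<sigma>\<^esub> \<in> V"
    and bij: "bij_betw ex U V" and smooth: "bastiani_smooth ?E ?E V (inv_into U ex)"
    using assms unfolding locally_exponential_def by blast
  have "(0, 0) \<in> V"
    using V(2) by (simp add: flow_group_def)
  from V(1)[unfolded flow_group_topology_def openin_prod_topology_alt, rule_format, OF this]
  obtain V1 J where VJ: "openin (Cinf_topology X A) V1" "openin euclideanreal J" "0 \<in> V1" "0 \<in> J"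
    "V1 \<times> J \<subseteq> V"
    by (elim exE conjE)
  then obtain \<epsilon> where \<epsilon>: "\<epsilon> > 0" "ball 0 \<epsilon> \<subseteq> J"
    by (metis open_contains_ball open_openin)
  define L where "L = inv_into U ex"
  have L: "L v \<in> U" "ex (L v) = v" if "v \<in> V" for v
    using bij that unfolding bij_betw_def L_def by (auto intro: inv_into_into f_inv_into_f)
  \<comment> \<open>Order zero of \<open>bastiani_smooth\<close>: the product over the empty index
    set \<open>{..<0}\<close> has the single point \<open>\<lambda>_. undefined\<close>.\<close>
  have contL: "continuous_map (subtopology ?E V) ?E L"
  proof -
    have "continuous_map (prod_topology (subtopology ?E V) (product_topology (\<lambda>_. ?E) {..<0})) ?E
        (\<lambda>(x, v). iter_deriv ?E L 0 x v)"
      using smooth unfolding bastiani_smooth_def L_def by blast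
    then have "continuous_map (subtopology ?E V) ?E ((\<lambda>(x, v). iter_deriv ?E L 0 x v) \<circ> (\<lambda>x. (x, \<lambda>_. undefined)))"
      by (rule continuous_map_compose[rotated])
         (auto simp: continuous_map_pairwise comp_def)
    then show ?thesis
      by (simp add: comp_def)
  qed
  show ?thesis
  proof (rule that[OF \<epsilon>(1)])
    fix g assume g: "g \<in> Cinf X A"
    have "\<forall>\<^sub>F c in at_right (0::real). c *\<^sub>R g \<in> V1 \<and> c > 0"
      using Cinf_neighbourhood_absorbs[OF VJ(1,3) g] eventually_at_right_less[of "0::real"]
      by (rule eventually_conj)
    then obtain c where c: "c *\<^sub>R g \<in> V1" "c > 0"
      using eventually_happens'[OF trivial_limit_at_right_real] by blast
    \<comment> \<open>The factor \<open>c\<close> brings \<open>g\<close> into the neighbourhood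
      \<open>V1\<close>; as \<beta> is linear in the function, dividing by \<open>c\<close> undoes
      the scaling.\<close>
    define F where "F t = (1 / c) *\<^sub>R fst (L (c *\<^sub>R g, t))" for t
    show "\<exists>F. (\<forall>t\<in>{0<..<\<epsilon>}. F t \<in> Cinf X A \<and>
        (\<forall>x\<in>topspace X. ((\<lambda>s. F t (\<sigma> s x)) has_integral t * g x) {0..t}) \<and>
        (\<forall>\<eta>>0. \<forall>\<^sub>F t' in at t. \<forall>x\<in>topspace X. \<bar>F t' x - F t x\<bar> < \<eta>))"
    proof (intro exI[of _ F] ballI conjI allI impI)
      fix t assume t: "t \<in> {0<..<\<epsilon>}"
      have tV: "(c *\<^sub>R g, t) \<in> V"
        using t c(1) VJ(5) \<epsilon>(2) by (auto simp: subset_iff)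
      define h where "h = fst (L (c *\<^sub>R g, t))"
      have "L (c *\<^sub>R g, t) \<in> topspace ?E"
        using L(1)[OF tV] openin_subset[OF U] by blast
      then have h: "h \<in> Cinf X A"
        by (auto simp: topspace_flow_group_topology h_def mem_Times_iff)
      have ht: "ex (h, snd (L (c *\<^sub>R g, t))) = (c *\<^sub>R g, t)"
        using L(2)[OF tV] by (simp add: h_def)
      \<comment> \<open>The exponential function keeps the second component, so its inverse does
        too.\<close>
      then have "snd (L (c *\<^sub>R g, t)) = t"
        using snd_exponential[OF ex h] by (metis snd_conv)
      with ht have exh: "ex (h, t) = (c *\<^sub>R g, t)"
        by simp
      have Ft: "F t = (1 / c) *\<^sub>R h"
        by (simp add: F_def h_def)
      then show "F t \<in> Cinf X A"
        using Cinf_scaleR[OF h] by simp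
      show "((\<lambda>s. F t (\<sigma> s x)) has_integral t * g x) {0..t}" if x: "x \<in> topspace X" for x
      proof -
        have "((\<lambda>s. h (\<sigma> s x)) has_integral t * (c * g x)) {0..t}"
          using fst_exponential[OF ex h _ x, of t] t by (simp add: exh scaleR_fun_def)
        then have "((\<lambda>s. (1 / c) * h (\<sigma> s x)) has_integral (1 / c) * (t * (c * g x))) {0..t}"
          by (rule has_integral_mult_right)
        then show ?thesis
          using c(2) by (simp add: Ft scaleR_fun_def)
      qed
      show "\<forall>\<^sub>F t' in at t. \<forall>x\<in>topspace X. \<bar>F t' x - F t x\<bar> < \<eta>" if \<eta>: "\<eta> > 0" for \<eta>
      proof -
        \<comment> \<open>A supremum ball in the first component, unrestricted in the second. Its
          radius carries the factor \<open>c\<close> that the definition of \<open>F\<close> divides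
          out.\<close>
        define N where "N = {k \<in> Cinf X A. \<forall>x\<in>topspace X. \<bar>k x - h x\<bar> < c * \<eta>} \<times> (UNIV :: real set)"
        have "openin ?E N"
          unfolding N_def flow_group_topology_def
          using openin_Cinf_topology_sup_ball[OF h, of "c * \<eta>"] c(2) \<eta>
          by (simp add: openin_prod_Times_iff)
        then have "openin (subtopology ?E V) {v \<in> topspace (subtopology ?E V). L v \<in> N}"
          by (rule openin_continuous_map_preimage[OF contL])
        moreover have "topspace (subtopology ?E V) = V"
          using openin_subset[OF V(1)] by (simp add: Int_absorb1)
        ultimately have "openin (subtopology ?E V) {v \<in> V. L v \<in> N}"
          by (simp only:)
        then have op: "openin ?E {v \<in> V. L v \<in> N}"
          using V(1) by (rule openin_trans_full)
        have "(c *\<^sub>R g, t) \<in> {v \<in> V. L v \<in> N}"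
          using tV c(2) \<eta> h by (simp add: N_def mem_Times_iff h_def)
        from op[unfolded flow_group_topology_def openin_prod_topology_alt, THEN spec, THEN spec, THEN mp, OF this]
        obtain W J' where WJ: "openin euclideanreal J'" "c *\<^sub>R g \<in> W" "t \<in> J'"
          "W \<times> J' \<subseteq> {v \<in> V. L v \<in> N}"
          by (elim exE conjE)
        then have J': "openin euclideanreal J'" "t \<in> J'"
          "\<And>t'. t' \<in> J' \<Longrightarrow> (c *\<^sub>R g, t') \<in> {v \<in> V. L v \<in> N}"
          by auto
        have "\<bar>F t' x - F t x\<bar> < \<eta>" if "t' \<in> J'" "x \<in> topspace X" for t' x
        proof -
          have "\<bar>fst (L (c *\<^sub>R g, t')) x - h x\<bar> < c * \<eta>"
            using J'(3)[OF that(1)] that(2) by (auto simp: N_def mem_Times_iff)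
          then have "\<bar>(fst (L (c *\<^sub>R g, t')) x - h x) / c\<bar> < \<eta>"
            using c(2) by (simp add: abs_divide field_simps)
          then show ?thesis
            by (simp add: F_def h_def scaleR_fun_def diff_divide_distrib)
        qed
        moreover have "\<forall>\<^sub>F t' in at t. t' \<in> J'"
          using J'(1,2) by (intro eventually_at_topological[THEN iffD2] exI[of _ J']) auto
        ultimately show ?thesis
          by (auto elim: eventually_mono)
      qed
    qed
  qed
qed

end

section \<open>Separated orbit points\<close>

context compact_flow
begin

text \<open>Restates g = \<beta>_t f along one orbit as a difference equation for a primitive
  \<open>U\<close> of \<open>f\<close>, by the fundamental theorem of calculus started at
  \<open>\<sigma> s x\<close>.\<close>

lemma orbit_primitive:
  assumes f: "f \<in> Cinf X A" and x: "x \<in> topspace X"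
  obtains U where "\<And>s. (U has_field_derivative f (\<sigma> s x)) (at s)"
    and "\<And>t g s. t > 0 \<Longrightarrow> \<forall>y\<in>topspace X. ((\<lambda>s. f (\<sigma> s y)) has_integral t * g y) {0..t} \<Longrightarrow>
           U (s + t) - U s = t * g (\<sigma> s x)"
proof -
  have "isCont (\<lambda>s. f (\<sigma> s x)) s" for s
    using continuous_on_Cinf_orbit[OF f x, of UNIV] by (simp add: continuous_on_eq_continuous_at)
  then obtain U where "\<forall>s. (U has_vector_derivative f (\<sigma> s x)) (at s)"
    using einterval_antiderivative[of "-\<infinity>" \<infinity> "\<lambda>s. f (\<sigma> s x)"] by auto
  then have U: "(U has_field_derivative f (\<sigma> s x)) (at s)" for s
    by (simp add: has_real_derivative_iff_has_vector_derivative)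
  show ?thesis
  proof (rule that[OF U])
    fix t s :: real and g
    assume t: "t > 0" and int: "\<forall>y\<in>topspace X. ((\<lambda>s. f (\<sigma> s y)) has_integral t * g y) {0..t}"
    have "((\<lambda>r. U (s + r)) has_field_derivative f (\<sigma> r (\<sigma> s x))) (at r)" for r
    proof -
      have "((\<lambda>r. s + r) has_field_derivative 1) (at r)"
        by (auto intro!: derivative_eq_intros)
      from DERIV_chain'[OF this U] show ?thesis
        using flow_add[OF x, of r s] by (simp add: add.commute)
    qed
    then have "((\<lambda>r. f (\<sigma> r (\<sigma> s x))) has_integral U (s + t) - U (s + 0)) {0..t}"
      using t by (intro fundamental_theorem_of_calculus)
        (auto simp: has_real_derivative_iff_has_vector_derivative[symmetric]
         intro: has_field_derivative_at_within)
    moreover have "((\<lambda>r. f (\<sigma> r (\<sigma> s x))) has_integral t * g (\<sigma> s x)) {0..t}"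
      by (rule bspec[OF int flow_in_topspace[OF x]])
    ultimately have "U (s + t) - U (s + 0) = t * g (\<sigma> s x)"
      by (rule has_integral_unique)
    then show "U (s + t) - U s = t * g (\<sigma> s x)"
      by simp
  qed
qed

text \<open>
  The sums of \<open>t g\<close> along the two sequences are both integrals of \<open>\<beta>\<^sub>t\<^sup>-\<^sup>1 g\<close> over
  time intervals which differ by a bounded set, but one of them grows linearly and the other vanishes.
\<close>

lemma separated_orbit_not_beta_image:
  assumes t: "t > 0" and p: "p \<in> topspace X"
    and C: "closedin X C1" "closedin X C2" "C1 \<inter> C2 = {}"
    and C1: "\<And>k::nat. \<sigma> (k * t) p \<in> C1" and C2: "\<And>k::nat. \<sigma> (k * t + t / 2) p \<in> C2"
  obtains g where "g \<in> Cinf X A"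
    "\<And>f. f \<in> Cinf X A \<Longrightarrow> \<not> (\<forall>x\<in>topspace X. ((\<lambda>s. f (\<sigma> s x)) has_integral t * g x) {0..t})"
proof -
  obtain g where g: "g \<in> Cinf X A" "\<And>x. x \<in> C1 \<Longrightarrow> g x > 0" "\<And>x. x \<in> C2 \<Longrightarrow> g x = 0"
    using Cinf_Urysohn[OF C] by metis
  have "compactin X C1"
    using C(1) compact closedin_compact_space by blast
  then have "compact (g ` C1)"
    using image_compactin[OF _ Cinf_continuous[OF g(1)]] by simp
  \<comment> \<open>By compactness \<open>g\<close> attains a minimum on \<open>C1\<close>, which is
    positive; this yields a linear rate of growth.\<close>
  then obtain y where y: "y \<in> C1" "\<And>x. x \<in> C1 \<Longrightarrow> g y \<le> g x"
    using compact_attains_inf[of "g ` C1"] C1 by (metis empty_iff image_iff)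
  show ?thesis
  proof (rule that[OF g(1)], rule notI)
    fix f assume f: "f \<in> Cinf X A"
      and int: "\<forall>x\<in>topspace X. ((\<lambda>s. f (\<sigma> s x)) has_integral t * g x) {0..t}"
    obtain U where U: "\<And>s. (U has_field_derivative f (\<sigma> s p)) (at s)"
      and step: "\<And>s. U (s + t) - U s = t * g (\<sigma> s p)"
      using orbit_primitive[OF f p] int t by metis
    obtain B where B: "\<And>x. x \<in> topspace X \<Longrightarrow> \<bar>f x\<bar> \<le> B"
      using Cinf_bounded[OF f] by metis
    \<comment> \<open>Used from \<open>s = 0\<close>, where every summand is at least
      \<open>t * g y\<close>, and from \<open>s = t / 2\<close>, where every summand
      vanishes.\<close>
    have tele: "U (s + N * t) - U s = (\<Sum>k<N. t * g (\<sigma> (s + k * t) p))" for s and N :: nat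
    proof (induction N)
      case (Suc N)
      then show ?case
        using step[of "s + N * t"] by (simp add: algebra_simps)
    qed simp
    have "U (N * t) - U 0 \<ge> N * (t * g y)" for N :: nat
    proof -
      have "(\<Sum>k<N. t * g y) \<le> (\<Sum>k<N. t * g (\<sigma> (0 + k * t) p))"
        using t y(2) C1 by (intro sum_mono) auto
      then show ?thesis
        using tele[of 0 N] by simp
    qed
    moreover have "U (N * t + t / 2) - U (t / 2) = 0" for N :: nat
      using tele[of "t / 2" N] g(3)[OF C2] by (simp add: add.commute)
    \<comment> \<open>Half a step changes \<open>U\<close> by a bounded amount, by the mean value
      theorem. Hence the growth from 0 to \<open>N * t\<close> stays below
      \<open>2 * (B * t)\<close>, whatever \<open>N\<close> is.\<close>
    moreover have "\<bar>U (s + t / 2) - U s\<bar> \<le> B * t" for s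
    proof -
      obtain r where "U (s + t / 2) - U s = (s + t / 2 - s) * f (\<sigma> r p)"
        using MVT2[of s "s + t / 2" U "\<lambda>s. f (\<sigma> s p)"] U t by auto
      then have "\<bar>U (s + t / 2) - U s\<bar> = t / 2 * \<bar>f (\<sigma> r p)\<bar>"
        using t by (simp only: abs_mult) simp
      also have "\<dots> \<le> t * B"
        using t B[OF flow_in_topspace[OF p], of r] by (intro mult_mono) auto
      finally show ?thesis
        by (simp add: mult.commute)
    qed
    note bound = this
    have "N * (t * g y) \<le> 2 * (B * t)" for N :: nat
      using calculation(1)[of N] calculation(2)[of N] bound[of "N * t"] bound[of 0] by auto
    moreover have "t * g y > 0"
      using t g(2) y(1) by simp
    ultimately show False
      using reals_Archimedean3[of "t * g y"] by (metis not_less)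
  qed
qed

text \<open>Local exponentiality inverts \<beta>_t only for \<open>t\<close> below some unknown
  bound, so separating times must exist arbitrarily close to 0.\<close>

lemma not_locally_exponential_if_separated:
  assumes p: "p \<in> topspace X"
    and sep: "\<And>\<epsilon>. \<epsilon> > 0 \<Longrightarrow> \<exists>t C1 C2. 0 < t \<and> t < \<epsilon> \<and>
       closedin X C1 \<and> closedin X C2 \<and> C1 \<inter> C2 = {} \<and>
       (\<forall>k::nat. \<sigma> (k * t) p \<in> C1) \<and> (\<forall>k::nat. \<sigma> (k * t + t / 2) p \<in> C2)"
  shows "\<not> locally_exponential (flow_group_topology X A) (flow_group X A \<sigma>)"
proof
  assume "locally_exponential (flow_group_topology X A) (flow_group X A \<sigma>)"
  then obtain \<epsilon> where \<epsilon>: "\<epsilon> > 0"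
    "\<And>g. g \<in> Cinf X A \<Longrightarrow> \<exists>F. (\<forall>t\<in>{0<..<\<epsilon>}. F t \<in> Cinf X A \<and>
        (\<forall>x\<in>topspace X. ((\<lambda>s. F t (\<sigma> s x)) has_integral t * g x) {0..t}) \<and>
        (\<forall>\<eta>>0. \<forall>\<^sub>F t' in at t. \<forall>x\<in>topspace X. \<bar>F t' x - F t x\<bar> < \<eta>))"
    by (rule locally_exponential_imp_beta_inverse) (rule that)
  obtain t C1 C2 where t: "0 < t" "t < \<epsilon>" and C: "closedin X C1" "closedin X C2" "C1 \<inter> C2 = {}"
    and "\<forall>k::nat. \<sigma> (k * t) p \<in> C1" "\<forall>k::nat. \<sigma> (k * t + t / 2) p \<in> C2"
    using sep[OF \<epsilon>(1)] by (elim exE conjE)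
  then obtain g where g: "g \<in> Cinf X A"
    "\<And>f. f \<in> Cinf X A \<Longrightarrow> \<not> (\<forall>x\<in>topspace X. ((\<lambda>s. f (\<sigma> s x)) has_integral t * g x) {0..t})"
    using separated_orbit_not_beta_image[OF t(1) p C] by metis
  obtain F where "\<forall>t\<in>{0<..<\<epsilon>}. F t \<in> Cinf X A \<and>
        (\<forall>x\<in>topspace X. ((\<lambda>s. F t (\<sigma> s x)) has_integral t * g x) {0..t}) \<and>
        (\<forall>\<eta>>0. \<forall>\<^sub>F t' in at t. \<forall>x\<in>topspace X. \<bar>F t' x - F t x\<bar> < \<eta>)"
    using \<epsilon>(2)[OF g(1)] by (elim exE)
  then show False
    using g(2) t by (metis greaterThanLessThan_iff)
qed

end

subsection \<open>Linear flows on tori\<close>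

text \<open>As \<open>n * t * \<theta>\<close> is plus or minus 2 pi, multiples of \<open>t\<close>
  rotate to \<open>n\<close>-th roots of 1 and the half-shifted times to \<open>n\<close>-th roots
  of -1. The \<open>n\<close>-th power thus separates the two sequences.\<close>

lemma cis_rotation_power:
  fixes k n :: nat and t \<theta> :: real
  assumes "\<theta> \<noteq> 0" "n > 0" "t = 2 * pi / (n * \<bar>\<theta>\<bar>)"
  shows "cis (k * t * \<theta>) ^ n = 1" "cis ((k * t + t / 2) * \<theta>) ^ n = -1"
proof -
  have nt: "n * (t * \<theta>) = 2 * pi * sgn \<theta>"
    using assms(1,2) by (auto simp: assms(3) sgn_if abs_if)
  have "n * (k * t * \<theta>) = k * (n * (t * \<theta>))" "n * ((k * t + t / 2) * \<theta>) = k * (n * (t * \<theta>)) + n * (t * \<theta>) / 2"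
    by (simp_all add: algebra_simps)
  then have *: "n * (k * t * \<theta>) = 2 * pi * (k * sgn \<theta>)" "n * ((k * t + t / 2) * \<theta>) = 2 * pi * (k * sgn \<theta>) + pi * sgn \<theta>"
    unfolding nt by simp_all
  have Z: "real k * sgn \<theta> \<in> \<int>"
    by (auto simp: sgn_if)
  then show "cis (k * t * \<theta>) ^ n = 1"
    unfolding Complex.DeMoivre * by (rule cis_multiple_2pi)
  have "cis (pi * sgn \<theta>) = -1"
    using assms(1) by (auto simp: sgn_if cis_cnj[symmetric])
  then show "cis ((k * t + t / 2) * \<theta>) ^ n = -1"
    unfolding Complex.DeMoivre * cis_mult[symmetric] using cis_multiple_2pi[OF Z] by simp
qed

lemma rotation_time_small:
  fixes \<epsilon> \<theta> :: real
  assumes "\<epsilon> > 0" "\<theta> \<noteq> 0"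
  obtains n :: nat where "n > 0" "0 < 2 * pi / (n * \<bar>\<theta>\<bar>)" "2 * pi / (n * \<bar>\<theta>\<bar>) < \<epsilon>"
proof -
  obtain n :: nat where n: "2 * pi / (\<bar>\<theta>\<bar> * \<epsilon>) < n"
    using reals_Archimedean2 by blast
  moreover have "2 * pi / (\<bar>\<theta>\<bar> * \<epsilon>) > 0"
    using assms by simp
  ultimately have "real n > 0"
    by linarith
  then show ?thesis
    using that[of n] n assms by (simp add: field_simps)
qed

lemma torus_1: "(\<chi> j. 1) \<in> topspace torus"
  by (simp add: torus_def)

lemma closedin_torus_power:
  fixes j :: "'d::finite"
  shows "closedin torus {z \<in> topspace torus. z $ j ^ n = c}"
proof -
  have "closed {z :: complex ^ 'd. z $ j ^ n = c}"
    by (intro closed_Collect_eq continuous_intros)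
  then have "closedin torus (topspace torus \<inter> {z :: complex ^ 'd. z $ j ^ n = c})"
    unfolding torus_def topspace_euclidean_subtopology by (rule closedin_closed_Int)
  then show ?thesis
    by (simp add: Collect_conj_eq)
qed

lemma compact_space_torus: "compact_space (torus :: (complex ^ 'd) topology)"
proof -
  let ?T = "{z :: complex ^ 'd. \<forall>j. z $ j \<in> sphere 0 1}"
  have "closed ?T"
    unfolding sphere_def by (auto intro!: closed_Collect_all closed_Collect_eq continuous_intros)
  moreover have "norm z \<le> CARD('d)" if "z \<in> ?T" for z :: "complex ^ 'd"
  proof -
    have "norm z \<le> (\<Sum>j\<in>UNIV. norm (z $ j))"
      unfolding norm_vec_def by (rule L2_set_le_sum) simp
    then show ?thesis
      using that by simp
  qed
  then have "bounded ?T"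
    unfolding bounded_iff by blast
  ultimately have "compact ?T"
    by (simp add: compact_eq_bounded_closed)
  then show ?thesis
    by (simp add: torus_def compact_space_subtopology)
qed

context compact_flow
begin

text \<open>For a coordinate \<open>j\<close> that rotates, the separating sets are the images of
  the loci where the \<open>n\<close>-th power of \<open>z $ j\<close> is 1 or -1. They are closed
  as compact sets and disjoint since \<open>\<iota>\<close> is injective.\<close>

lemma not_locally_exponential_if_torus_embeds:
  fixes \<theta> :: "real ^ 'd"
  assumes "\<theta> \<noteq> 0" and emb: "smooth_embedding torus torus_atlas X A \<iota>"
    and equi: "equivariant torus (linear_flow \<theta>) \<sigma> \<iota>"
  shows "\<not> locally_exponential (flow_group_topology X A) (flow_group X A \<sigma>)"
proof -
  let ?T = "topspace (torus :: (complex ^ 'd) topology)"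
  obtain j where j: "\<theta> $ j \<noteq> 0"
    using assms(1) by (auto simp: vec_eq_iff)
  have cont: "continuous_map torus X \<iota>" and inj: "inj_on \<iota> ?T"
    using emb by (auto simp: smooth_embedding_def smooth_map_def embedding_map_def homeomorphic_map_def)
  have closed: "closedin X (\<iota> ` {z \<in> ?T. z $ j ^ n = c})" for n c
  proof -
    have "compactin torus {z \<in> ?T. z $ j ^ n = c}"
      by (rule closedin_compact_space[OF compact_space_torus closedin_torus_power])
    then show ?thesis
      using image_compactin[OF _ cont] compactin_imp_closedin[OF Hausdorff] by blast
  qed
  have orbit: "\<sigma> s (\<iota> (\<chi> j. 1)) = \<iota> (\<chi> j. cis (s * \<theta> $ j))" for s
    using equi torus_1 by (auto simp: equivariant_def linear_flow_def dest!: spec[of _ s])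
  have inT: "(\<chi> j. cis (s * \<theta> $ j)) \<in> ?T" for s
    by (simp add: torus_def)
  show ?thesis
  proof (rule not_locally_exponential_if_separated)
    show "\<iota> (\<chi> j. 1) \<in> topspace X"
      using continuous_map_image_subset_topspace[OF cont] torus_1 by blast
    fix \<epsilon> :: real assume "\<epsilon> > 0"
    then obtain n :: nat where n: "n > 0" and t: "0 < 2 * pi / (n * \<bar>\<theta> $ j\<bar>)" "2 * pi / (n * \<bar>\<theta> $ j\<bar>) < \<epsilon>"
      by (rule rotation_time_small[OF _ j])
    define t where "t = 2 * pi / (n * \<bar>\<theta> $ j\<bar>)"
    note rot = cis_rotation_power[OF j n t_def]
    have "\<iota> ` {z \<in> ?T. z $ j ^ n = 1} \<inter> \<iota> ` {z \<in> ?T. z $ j ^ n = -1}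
        = \<iota> ` ({z \<in> ?T. z $ j ^ n = 1} \<inter> {z \<in> ?T. z $ j ^ n = -1})"
      by (rule inj_on_image_Int[OF inj, symmetric]) auto
    also have "{z \<in> ?T. z $ j ^ n = 1} \<inter> {z \<in> ?T. z $ j ^ n = -1} = {}"
      by auto
    finally have disj: "\<iota> ` {z \<in> ?T. z $ j ^ n = 1} \<inter> \<iota> ` {z \<in> ?T. z $ j ^ n = -1} = {}"
      by simp
    have orb: "\<sigma> s (\<iota> (\<chi> j. 1)) \<in> \<iota> ` {z \<in> ?T. z $ j ^ n = c}" if "cis (s * \<theta> $ j) ^ n = c" for s c
      unfolding orbit by (rule imageI) (use that inT in simp)
    show "\<exists>t C1 C2. 0 < t \<and> t < \<epsilon> \<and> closedin X C1 \<and> closedin X C2 \<and> C1 \<inter> C2 = {} \<and>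
       (\<forall>k::nat. \<sigma> (k * t) (\<iota> (\<chi> j. 1)) \<in> C1) \<and> (\<forall>k::nat. \<sigma> (k * t + t / 2) (\<iota> (\<chi> j. 1)) \<in> C2)"
      by (intro exI[of _ t] exI[of _ "\<iota> ` {z \<in> ?T. z $ j ^ n = 1}"]
            exI[of _ "\<iota> ` {z \<in> ?T. z $ j ^ n = -1}"] conjI allI closed disj orb rot)
         (use t in \<open>simp_all add: t_def\<close>)
  qed
qed

text \<open>As for the embedded torus, with preimages under \<open>\<pi>\<close> in place of images;
  surjectivity supplies a starting point over \<open>(\<chi> j. 1)\<close>.\<close>

lemma not_locally_exponential_if_submerses_torus:
  fixes \<theta> :: "real ^ 'd"
  assumes "\<theta> \<noteq> 0"
    and sub: "equivariant_submersion_onto X A \<sigma> torus torus_atlas (linear_flow \<theta>) \<pi>"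
  shows "\<not> locally_exponential (flow_group_topology X A) (flow_group X A \<sigma>)"
proof -
  let ?T = "topspace (torus :: (complex ^ 'd) topology)"
  obtain j where j: "\<theta> $ j \<noteq> 0"
    using assms(1) by (auto simp: vec_eq_iff)
  have cont: "continuous_map X torus \<pi>" and surj: "\<pi> ` topspace X = ?T"
    and equi: "equivariant X \<sigma> (linear_flow \<theta>) \<pi>"
    using sub by (auto simp: equivariant_submersion_onto_def submersion_def smooth_map_def)
  obtain p where p: "p \<in> topspace X" "\<pi> p = (\<chi> j. 1)"
    using torus_1[where 'a = 'd] unfolding surj[symmetric] by auto
  define C where "C n c = {x \<in> topspace X. \<pi> x \<in> {z \<in> ?T. z $ j ^ n = c}}" for n c
  have closed: "closedin X (C n c)" for n c
    unfolding C_def by (rule closedin_continuous_map_preimage[OF cont closedin_torus_power])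
  have orbit: "\<pi> (\<sigma> s p) = (\<chi> j. cis (s * \<theta> $ j))" for s
    using equi p by (auto simp: equivariant_def linear_flow_def)
  have inC: "\<sigma> s p \<in> C n c \<longleftrightarrow> cis (s * \<theta> $ j) ^ n = c" for s n c
    using flow_in_topspace[OF p(1)] orbit by (simp add: C_def torus_def)
  show ?thesis
  proof (rule not_locally_exponential_if_separated[OF p(1)])
    fix \<epsilon> :: real assume "\<epsilon> > 0"
    then obtain n :: nat where n: "n > 0" and t: "0 < 2 * pi / (n * \<bar>\<theta> $ j\<bar>)" "2 * pi / (n * \<bar>\<theta> $ j\<bar>) < \<epsilon>"
      by (rule rotation_time_small[OF _ j])
    define t where "t = 2 * pi / (n * \<bar>\<theta> $ j\<bar>)"
    note rot = cis_rotation_power[OF j n t_def]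
    have disj: "C n 1 \<inter> C n (-1) = {}"
      by (auto simp: C_def)
    show "\<exists>t C1 C2. 0 < t \<and> t < \<epsilon> \<and> closedin X C1 \<and> closedin X C2 \<and> C1 \<inter> C2 = {} \<and>
       (\<forall>k::nat. \<sigma> (k * t) p \<in> C1) \<and> (\<forall>k::nat. \<sigma> (k * t + t / 2) p \<in> C2)"
      by (intro exI[of _ t] exI[of _ "C n 1"] exI[of _ "C n (-1)"] conjI allI closed disj
            inC[THEN iffD2] rot)
         (use t in \<open>simp_all add: t_def\<close>)
  qed
qed

end

subsection \<open>Flows on the circle\<close>

text \<open>The generator is the infimum \<open>T\<close> of the positive elements.\<close>

lemma closed_subgroup_reals_cyclic:
  fixes G :: "real set"
  assumes "closed G" and diff: "\<And>a b. a \<in> G \<Longrightarrow> b \<in> G \<Longrightarrow> a - b \<in> G"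
    and a: "a \<in> G" "a > 0" and "G \<noteq> UNIV"
  obtains T :: real where "T > 0" "G = range (\<lambda>k::int. k * T)"
proof -
  have zero: "0 \<in> G"
    using diff[OF a(1) a(1)] by simp
  have neg: "- b \<in> G" if "b \<in> G" for b
    using diff[OF zero that] by simp
  have add: "b + c \<in> G" if "b \<in> G" "c \<in> G" for b c
    using diff[OF that(1) neg[OF that(2)]] by simp
  have nat: "real k * b \<in> G" if "b \<in> G" for b and k :: nat
    by (induction k) (use zero add that in \<open>auto simp: algebra_simps\<close>)
  have int: "of_int k * b \<in> G" if "b \<in> G" for b and k :: int
    using nat[OF that, of "nat k"] neg[OF nat[OF that, of "nat (- k)"]] by (cases "k \<ge> 0") auto
  define S where "S = G \<inter> {0<..}"
  define T where "T = Inf S"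
  have S: "S \<noteq> {}" "bdd_below S"
    using a by (auto simp: S_def intro!: bdd_belowI[of _ 0])
  have T_le: "T \<le> s" if "s \<in> S" for s
    unfolding T_def using S(2) that by (rule cInf_lower[rotated])
  have near: "\<exists>q\<in>S. q < T + e" if "e > 0" for e
    using cInf_lessD[OF S(1), of "T + e"] that unfolding T_def by auto
  have "T \<ge> 0"
    unfolding T_def using S(1) by (intro cInf_greatest) (auto simp: S_def)
  have "T \<noteq> 0"
  proof
    assume "T = 0"
    \<comment> \<open>If \<open>T = 0\<close>, multiples of arbitrarily small positive elements come
      close to every \<open>s\<close>, so the closed group is everything.\<close>
    have "s \<in> G" for s
    proof -
      have "\<exists>y\<in>G. dist y s < e" if e: "e > 0" for e
      proof -
        obtain q where q: "q \<in> G" "0 < q" "q < e"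
          using near[OF e] \<open>T = 0\<close> by (auto simp: S_def)
        have "of_int \<lfloor>s / q\<rfloor> * q \<le> s" "s < of_int \<lfloor>s / q\<rfloor> * q + q"
          using floor_divide_lower[OF q(2)] floor_divide_upper[OF q(2)] by (simp_all add: distrib_right)
        then have "dist (of_int \<lfloor>s / q\<rfloor> * q) s < e"
          using q(3) by (simp add: dist_real_def)
        then show ?thesis
          using int[OF q(1)] by blast
      qed
      then show ?thesis
        using closed_approachable[OF assms(1)] by blast
    qed
    then show False
      using \<open>G \<noteq> UNIV\<close> by blast
  qed
  then have "T > 0"
    using \<open>T \<ge> 0\<close> by simp
  have "\<exists>y\<in>G. dist y T < e" if e: "e > 0" for e
  proof -
    obtain q where q: "q \<in> S" "q < T + e"
      using near[OF e] by blast
    then show ?thesis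
      using T_le[OF q(1)] by (intro bexI[of _ q]) (auto simp: dist_real_def S_def)
  qed
  then have "T \<in> G"
    using closed_approachable[OF assms(1)] by blast
  have "s \<in> range (\<lambda>k::int. k * T)" if "s \<in> G" for s
  proof -
    \<comment> \<open>The remainder of \<open>s\<close> modulo \<open>T\<close> lies in the group
      below its least positive element, hence is zero.\<close>
    let ?r = "s - of_int \<lfloor>s / T\<rfloor> * T"
    have "0 \<le> ?r" "?r < T"
      using floor_divide_lower[OF \<open>T > 0\<close>, of s] floor_divide_upper[OF \<open>T > 0\<close>, of s]
      by (simp_all add: distrib_right)
    moreover have "?r \<in> G"
      using diff[OF that int[OF \<open>T \<in> G\<close>]] .
    ultimately have "?r = 0"
      using T_le[of ?r] unfolding S_def by (cases "?r > 0") (auto simp del: diff_gt_0_iff_gt)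
    then show ?thesis
      by (intro image_eqI[of _ _ "\<lfloor>s / T\<rfloor>"]) auto
  qed
  then show ?thesis
    using that[OF \<open>T > 0\<close>] int[OF \<open>T \<in> G\<close>] by blast
qed

context continuous_flow
begin

lemma flow_minus: "x \<in> topspace X \<Longrightarrow> \<sigma> (- r) (\<sigma> r x) = x"
  using flow_add[of x "- r" r] flow_zero by simp

lemma flow_eq_iff:
  assumes "x \<in> topspace X"
  shows "\<sigma> s x = \<sigma> r x \<longleftrightarrow> \<sigma> (s - r) x = x"
proof -
  have "\<sigma> s x = \<sigma> r (\<sigma> (s - r) x)"
    using flow_add[OF assms, of r "s - r"] by simp
  moreover have "\<sigma> (s - r) x = \<sigma> (- r) (\<sigma> s x)"
    using flow_add[OF assms, of "- r" s] by simp
  ultimately show ?thesis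
    using flow_minus[OF assms, of r] by metis
qed

end

lemma bounded_strict_mono_tendsto_Sup:
  fixes \<theta> :: "real \<Rightarrow> real"
  assumes "strict_mono \<theta>" "bdd_above (range \<theta>)"
  shows "((\<lambda>t. \<theta> (s + t)) \<longlongrightarrow> Sup (range \<theta>)) at_top"
proof (rule increasing_tendsto)
  show "\<forall>\<^sub>F t in at_top. \<theta> (s + t) \<le> Sup (range \<theta>)"
    using assms(2) by (intro always_eventually allI cSup_upper) auto
  fix y assume "y < Sup (range \<theta>)"
  then obtain a where "y < \<theta> a"
    using less_cSup_iff[OF _ assms(2)] by auto
  moreover have "\<theta> a \<le> \<theta> (s + t)" if "t \<ge> a - s" for t
    using that assms(1) by (simp add: strict_mono_less_eq)
  ultimately show "\<forall>\<^sub>F t in at_top. y < \<theta> (s + t)"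
    unfolding eventually_at_top_linorder by (meson less_le_trans)
qed

text \<open>
  Lift the orbit of \<open>1\<close> to a path of angles. If the orbit were injective, the
  lift would be monotone with image of length at most \<open>2\<pi>\<close>, and its limit a fixed point.
\<close>

lemma fixed_point_free_circle_flow_periodic:
  assumes "continuous_flow circle \<rho>" "fixed_point_free circle \<rho>"
  obtains T :: real where "T > 0" "\<And>s. \<rho> s 1 = 1 \<longleftrightarrow> (\<exists>k::int. s = k * T)"
proof -
  interpret continuous_flow circle \<rho>
    by fact
  have top: "topspace circle = sphere 0 1"
    by (simp add: circle_def)
  then have one: "1 \<in> topspace circle"
    by simp
  define c where "c t = \<rho> t 1" for t
  have c_cont: "continuous_on UNIV c"
    using continuous_map_orbit[OF one] unfolding c_def circle_def by (simp add: continuous_map_in_subtopology)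
  have c_norm: "cmod (c t) = 1" for t
    using flow_in_topspace[OF one, of t] by (simp add: c_def top)
  have \<rho>_cont: "continuous_on (sphere 0 1) (\<rho> s)" for s
    using continuous_map_flow[of s] unfolding circle_def by (simp add: continuous_map_in_subtopology)
  \<comment> \<open>A continuous logarithm exists on the contractible line; its imaginary part is
    the lifted angle, and its real part is zero as \<open>c\<close> has modulus 1.\<close>
  obtain g where g: "continuous_on UNIV g" "\<And>t. c t = exp (g t)"
    using continuous_logarithm_on_contractible[OF c_cont] c_norm
    by (metis UNIV_I contractible_UNIV norm_zero zero_neq_one)
  define \<theta> where "\<theta> t = Im (g t)" for t
  have \<theta>_cont: "continuous_on UNIV \<theta>"
    unfolding \<theta>_def using g(1) by (intro continuous_intros)
  have c_cis: "c t = cis (\<theta> t)" for t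
  proof -
    have "exp (Re (g t)) = 1"
      using c_norm[of t] g(2)[of t] by simp
    then show ?thesis
      using g(2)[of t] by (simp add: exp_eq_polar \<theta>_def)
  qed
  have "\<not> inj c"
  proof
    assume "inj c"
    then have "inj \<theta>"
      by (auto simp: inj_on_def c_cis)
    \<comment> \<open>A rise by a full turn would, by connectedness, make the orbit hit
      \<open>c a\<close> at another time.\<close>
    have less: "\<theta> b < \<theta> a + 2 * pi" for a b
    proof (rule ccontr)
      assume "\<not> \<theta> b < \<theta> a + 2 * pi"
      moreover have "connected (range \<theta>)"
        using connected_continuous_image[OF \<theta>_cont] connected_UNIV by blast
      ultimately have "\<theta> a + 2 * pi \<in> range \<theta>"
        using connectedD_interval[of "range \<theta>" "\<theta> a" "\<theta> b" "\<theta> a + 2 * pi"] by auto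
      then obtain r where r: "\<theta> r = \<theta> a + 2 * pi"
        by (metis imageE)
      then have "c r = c a"
        by (simp add: c_cis cis.ctr)
      then have "r = a"
        using \<open>inj c\<close> by (simp add: inj_eq)
      then show False
        using r by simp
    qed
    \<comment> \<open>The sign \<open>e\<close> treats increasing and decreasing lifts
      together.\<close>
    have *: False if mono: "strict_mono (\<lambda>t. e * \<theta> t)" and e: "e \<in> {1, -1}" for e
    proof -
      let ?\<theta> = "\<lambda>t. e * \<theta> t"
      have "?\<theta> t \<le> ?\<theta> 0 + 2 * pi" for t
        using e less[of t 0] less[of 0 t] by auto
      then have "bdd_above (range ?\<theta>)"
        by (intro bdd_aboveI2)
      define L where "L = Sup (range ?\<theta>)"
      have lim: "((\<lambda>t. ?\<theta> (s + t)) \<longlongrightarrow> L) at_top" for s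
        unfolding L_def by (rule bounded_strict_mono_tendsto_Sup) fact+
      define w where "w = cis (e * L)"
      \<comment> \<open>The limit is the same for every shift \<open>s\<close>, which forces \<rho>
        to fix \<open>w\<close>.\<close>
      have lim_c: "((\<lambda>t. c (s + t)) \<longlongrightarrow> w) at_top" for s
      proof -
        have "((\<lambda>t. cis (e * ?\<theta> (s + t))) \<longlongrightarrow> w) at_top"
          unfolding w_def by (intro tendsto_intros lim)
        moreover have "e * ?\<theta> (s + t) = \<theta> (s + t)" for t
          using e by auto
        ultimately show ?thesis
          by (simp add: c_cis)
      qed
      have w: "w \<in> sphere 0 1"
        by (simp add: w_def)
      have "\<rho> s w = w" for s
      proof (rule tendsto_unique)
        have "((\<lambda>t. c (0 + t)) \<longlongrightarrow> w) at_top"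
          by (rule lim_c)
        then show "((\<lambda>t. \<rho> s (c (0 + t))) \<longlongrightarrow> \<rho> s w) at_top"
          by (rule continuous_on_tendsto_compose[OF \<rho>_cont _ w]) (simp add: c_norm)
        have "\<rho> s (c (0 + t)) = c (s + t)" for t
          using flow_add[OF one, of s t] by (simp add: c_def)
        then show "((\<lambda>t. \<rho> s (c (0 + t))) \<longlongrightarrow> w) at_top"
          using lim_c[of s] by simp
      qed simp
      then show False
        using assms(2) w unfolding fixed_point_free_def top by blast
    qed
    have "strict_mono_on UNIV \<theta> \<or> strict_antimono_on UNIV \<theta>"
      using injective_eq_monotone_map[of UNIV \<theta>] \<theta>_cont \<open>inj \<theta>\<close> by (simp add: is_interval_univ)
    then show False
      using *[of 1] *[of "-1"] by (auto simp: monotone_on_def)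
  qed
  then obtain s r where sr: "s < r" "\<rho> s 1 = \<rho> r 1"
    unfolding inj_def c_def by (metis linorder_neqE_linordered_idom)
  \<comment> \<open>The stabilizer of 1: closed, proper since 1 is not fixed, and containing the
    positive number \<open>r - s\<close>.\<close>
  define G where "G = {s. \<rho> s 1 = 1}"
  have closed: "closed G"
    using c_cont unfolding G_def c_def by (intro closed_Collect_eq continuous_intros) auto
  have diff: "a - b \<in> G" if "a \<in> G" "b \<in> G" for a b
    using flow_eq_iff[OF one, of a b] that by (simp add: G_def)
  have rs: "r - s \<in> G"
    using flow_eq_iff[OF one, of r s] sr(2) by (simp add: G_def)
  have "G \<noteq> UNIV"
    using assms(2) one by (auto simp: fixed_point_free_def G_def)
  then obtain T :: real where T: "T > 0" "G = range (\<lambda>k::int. k * T)"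
    using closed_subgroup_reals_cyclic[OF closed diff rs] sr(1) by (metis diff_gt_0_iff_gt)
  have "\<rho> s 1 = 1 \<longleftrightarrow> (\<exists>k::int. s = k * T)" for s
    using T(2) by (auto simp: G_def)
  then show ?thesis
    using that[OF T(1)] by blast
qed

context compact_flow
begin

text \<open>With \<open>t = T / n\<close>, the times \<open>k * t + a\<close> give only
  \<open>n\<close> points of the periodic orbit of 1. These finite sets, for \<open>a = 0\<close>
  and \<open>a = t / 2\<close>, are disjoint, and their preimages separate.\<close>

lemma not_locally_exponential_if_submerses_circle:
  assumes \<rho>: "smooth_flow circle circle_atlas \<rho>" "fixed_point_free circle \<rho>"
    and sub: "equivariant_submersion_onto X A \<sigma> circle circle_atlas \<rho> \<pi>"
  shows "\<not> locally_exponential (flow_group_topology X A) (flow_group X A \<sigma>)"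
proof -
  interpret \<rho>: continuous_flow circle \<rho>
    using \<rho>(1) by (rule smooth_flow_imp_continuous_flow)
  obtain T :: real where T: "T > 0" "\<And>s. \<rho> s 1 = 1 \<longleftrightarrow> (\<exists>k::int. s = k * T)"
    using fixed_point_free_circle_flow_periodic[OF \<rho>.continuous_flow_axioms \<rho>(2)] by metis
  have one: "1 \<in> topspace circle"
    by (simp add: circle_def)
  have cont: "continuous_map X circle \<pi>" and surj: "\<pi> ` topspace X = topspace circle"
    and equi: "equivariant X \<sigma> \<rho> \<pi>"
    using sub by (auto simp: equivariant_submersion_onto_def submersion_def smooth_map_def)
  obtain p where p: "p \<in> topspace X" "\<pi> p = 1"
    using one unfolding surj[symmetric] by auto
  have orbit: "\<pi> (\<sigma> s p) = \<rho> s 1" for s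
    using equi p by (auto simp: equivariant_def)
  show ?thesis
  proof (rule not_locally_exponential_if_separated[OF p(1)])
    fix \<epsilon> :: real assume "\<epsilon> > 0"
    then obtain n :: nat where "T / \<epsilon> < n"
      using reals_Archimedean2 by blast
    moreover have "T / \<epsilon> > 0"
      using T(1) \<open>\<epsilon> > 0\<close> by simp
    ultimately have n: "n > 0" "T < n * \<epsilon>"
      using \<open>\<epsilon> > 0\<close> by (auto simp: field_simps intro: gr0I)
    define t where "t = T / n"
    have t: "t > 0" "t < \<epsilon>" "T = n * t"
      using T(1) n by (auto simp: t_def field_simps)
    define F where "F a = (\<lambda>k::nat. \<rho> (k * t + a) 1) ` {..<n}" for a
    define C where "C a = {x \<in> topspace X. \<pi> x \<in> F a}" for a
    have "F a \<subseteq> topspace circle" for a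
      using \<rho>.flow_in_topspace[OF one] by (auto simp: F_def)
    then have "closedin circle (F a)" for a
      by (auto simp: F_def circle_def intro!: closed_subset finite_imp_closed)
    then have closed: "closedin X (C a)" for a
      unfolding C_def by (rule closedin_continuous_map_preimage[OF cont])
    \<comment> \<open>Reducing \<open>k\<close> modulo \<open>n\<close> changes the time by a
      multiple of the period \<open>T\<close>.\<close>
    have inC: "\<sigma> (k * t + a) p \<in> C a" for k :: nat and a
    proof -
      have "real k = real (k div n * n + k mod n)"
        by simp
      then have k: "real k - real (k mod n) = real (k div n) * n"
        unfolding of_nat_add of_nat_mult by linarith
      have "(k * t + a) - ((k mod n) * t + a) = (real k - real (k mod n)) * t"
        by (simp add: left_diff_distrib)
      then have "(k * t + a) - ((k mod n) * t + a) = int (k div n) * T"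
        unfolding k by (simp add: t(3))
      then have "\<rho> (k * t + a) 1 = \<rho> ((k mod n) * t + a) 1"
        unfolding \<rho>.flow_eq_iff[OF one] T(2) by (rule exI)
      then have "\<pi> (\<sigma> (k * t + a) p) \<in> F a"
        unfolding orbit F_def by (rule image_eqI) (use n(1) in simp)
      then show ?thesis
        using flow_in_topspace[OF p(1)] by (simp add: C_def)
    qed
    have "F 0 \<inter> F (t / 2) = {}"
    proof -
      \<comment> \<open>Two such times differing by \<open>m * T\<close> would make the odd number
        \<open>2 * k - 2 * l - 1\<close> equal to \<open>2 * (m * n)\<close>.\<close>
      have False if eq: "\<rho> (k * t + 0) 1 = \<rho> (l * t + t / 2) 1" for k l :: nat
      proof -
        obtain m :: int where "(k * t + 0) - (l * t + t / 2) = m * T"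
          using eq unfolding \<rho>.flow_eq_iff[OF one] T(2) by (elim exE)
        then have "t * (2 * real k - 2 * real l - 1) = t * (2 * (m * n))"
          by (simp add: t(3) algebra_simps)
        then have "2 * real k - 2 * real l - 1 = 2 * (m * n)"
          using t(1) by simp
        then have "real_of_int (2 * int k - 2 * int l - 1) = real_of_int (2 * (m * n))"
          by simp
        then have "2 * int k - 2 * int l - 1 = 2 * (m * n)"
          by (simp only: of_int_eq_iff)
        then have "even (2 * int k - 2 * int l - 1)"
          by simp
        then show False
          by simp
      qed
      then show ?thesis
        unfolding F_def by blast
    qed
    then have disj: "C 0 \<inter> C (t / 2) = {}"
      unfolding C_def by blast
    show "\<exists>t C1 C2. 0 < t \<and> t < \<epsilon> \<and> closedin X C1 \<and> closedin X C2 \<and> C1 \<inter> C2 = {} \<and>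
       (\<forall>k::nat. \<sigma> (k * t) p \<in> C1) \<and> (\<forall>k::nat. \<sigma> (k * t + t / 2) p \<in> C2)"
      using inC[of _ 0] by (intro exI[of _ t] exI[of _ "C 0"] exI[of _ "C (t / 2)"] conjI allI t closed disj inC) simp
  qed
qed

end

section \<open>Non-periodic locally closed orbits\<close>

text \<open>
  Going around with the two almost equal periods \<open>t\<close> and \<open>t'\<close> moves the argument by multiples of
  \<open>t' - t\<close>, while the values change by a uniformly small amount.
\<close>

lemma limit_of_periodic_constant:
  fixes u :: "real \<Rightarrow> real" and v :: "real \<Rightarrow> real \<Rightarrow> real"
  assumes cont: "continuous_on {c<..} u" and t: "t > 0"
    and u: "\<And>s. s > c \<Longrightarrow> u (s + t) = u s"
    and v: "\<And>\<eta>. \<eta> > 0 \<Longrightarrow> \<forall>\<^sub>F t' in at_right t. \<forall>s>c. v t' (s + t') = v t' s \<and> \<bar>v t' s - u s\<bar> < \<eta>"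
    and ab: "a > c" "b > c"
  shows "u a = u b"
  using ab
proof (induction a b rule: linorder_wlog)
  case (le a b)
  have "\<bar>u a - u b\<bar> \<le> 0 + e" if "e > 0" for e
  proof -
    have "isCont u b"
      using cont \<open>b > c\<close> by (simp add: continuous_on_eq_continuous_at)
    \<comment> \<open>The period \<open>t'\<close> is going to exceed \<open>t\<close> by less than
      this \<open>d\<close>, so that steps of length \<open>t' - t\<close> starting at
      \<open>a\<close> come within \<open>d\<close> of \<open>b\<close>.\<close>
    then obtain d where d: "d > 0" "\<And>x. \<bar>x - b\<bar> < d \<Longrightarrow> \<bar>u x - u b\<bar> < e / 3"
      using \<open>e > 0\<close> unfolding continuous_at_eps_delta dist_real_def
      by (metis zero_less_divide_iff zero_less_numeral)
    have "\<forall>\<^sub>F t' in at_right t. t' \<in> {t<..<t + d}"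
      by (rule eventually_at_right_real) (use d(1) in simp)
    with v[of "e / 3"] \<open>e > 0\<close> have "\<forall>\<^sub>F t' in at_right t. t' \<in> {t<..<t + d} \<and>
        (\<forall>s>c. v t' (s + t') = v t' s \<and> \<bar>v t' s - u s\<bar> < e / 3)"
      by (simp add: eventually_conj_iff)
    then obtain t' where t': "t < t'" "t' < t + d"
      and v': "\<And>s. s > c \<Longrightarrow> v t' (s + t') = v t' s" "\<And>s. s > c \<Longrightarrow> \<bar>v t' s - u s\<bar> < e / 3"
      using eventually_happens'[OF trivial_limit_at_right_real] by fastforce
    have per_u: "u (s + k * t) = u s" if "s > c" for s and k :: nat
    proof (induction k)
      case (Suc k)
      have "s + k * t > c"
        using that mult_nonneg_nonneg[of "real k" t] t by linarith
      then show ?case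
        using u[of "s + k * t"] Suc by (simp add: algebra_simps)
    qed simp
    have per_v: "v t' (s + k * t') = v t' s" if "s > c" for s and k :: nat
    proof (induction k)
      case (Suc k)
      have "s + k * t' > c"
        using that mult_nonneg_nonneg[of "real k" t'] t t' by linarith
      then show ?case
        using v'(1)[of "s + k * t'"] Suc by (simp add: algebra_simps)
    qed simp
    define q where "q = t' - t"
    have q: "0 < q" "q < d"
      using t' by (auto simp: q_def)
    \<comment> \<open>The largest number of steps of length \<open>q\<close> from \<open>a\<close>
      that does not pass \<open>b\<close>.\<close>
    define k where "k = nat \<lfloor>(b - a) / q\<rfloor>"
    have "real k \<le> (b - a) / q" "(b - a) / q < real k + 1"
      using le q unfolding k_def by (auto simp: of_nat_nat)
    then have k: "a + k * q \<le> b" "b < a + k * q + q"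
      using q by (auto simp: field_simps)
    \<comment> \<open>The chain from \<open>u b\<close> to \<open>u a\<close> runs through
      \<open>u (a + k * q)\<close>, \<open>u (a + k * t')\<close>, \<open>v t' (a + k * t')\<close>
      and \<open>v t' a\<close>. Two links are equalities by periodicity, the other three cost less
      than \<open>e / 3\<close> each.\<close>
    have "\<bar>u (a + k * q) - u b\<bar> < e / 3"
      using d(2) k q by simp
    moreover have "u (a + k * t') = u (a + k * q)"
    proof -
      have "a + k * q > c"
        using le mult_nonneg_nonneg[of "real k" q] q by linarith
      then show ?thesis
        using per_u[of "a + k * q" k] by (simp add: q_def algebra_simps)
    qed
    moreover have "\<bar>v t' (a + k * t') - u (a + k * t')\<bar> < e / 3"
    proof (rule v'(2))
      show "a + k * t' > c"
        using le mult_nonneg_nonneg[of "real k" t'] t t' by linarith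
    qed
    moreover have "v t' (a + k * t') = v t' a" "\<bar>v t' a - u a\<bar> < e / 3"
      using per_v v'(2) le by auto
    ultimately show ?thesis
      by linarith
  qed
  then have "\<bar>u a - u b\<bar> \<le> 0"
    by (rule field_le_epsilon)
  then show ?case
    by simp
qed auto

context compact_flow
begin

lemma nonperiodic_orbit_inj:
  assumes p: "p \<in> topspace X" and "\<not> periodic_orbit \<sigma> p"
  shows "inj (\<lambda>t. \<sigma> t p)"
proof (rule ccontr)
  assume "\<not> ?thesis"
  then obtain s r where sr: "s < r" "\<sigma> r p = \<sigma> s p"
    unfolding inj_def by (metis linorder_neqE_linordered_idom)
  then have "\<sigma> (r - s) p = p"
    using flow_eq_iff[OF p] by simp
  then have "\<sigma> (t + (r - s)) p = \<sigma> t p" for t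
    using flow_add[OF p, of t "r - s"] by simp
  then show False
    using assms(2) sr(1) unfolding periodic_orbit_def by (metis diff_gt_0_iff_gt)
qed

text \<open>
  By Baire's theorem a compact piece of the orbit has interior in the orbit, so the orbit returns
  to a small neighbourhood of \<open>p\<close> only at bounded times; injectivity makes these times small.
\<close>

lemma locally_closed_orbit_wandering:
  assumes p: "p \<in> topspace X" and nonper: "\<not> periodic_orbit \<sigma> p"
    and lc: "locally_closed_in X (orbit \<sigma> p)" and "\<delta> > 0"
  obtains W where "openin X W" "p \<in> W" "\<And>s. \<sigma> s p \<in> W \<Longrightarrow> \<bar>s\<bar> < \<delta>"
proof -
  let ?O = "orbit \<sigma> p"
  let ?S = "subtopology X ?O"
  note inj = nonperiodic_orbit_inj[OF p nonper]
  have compact_piece: "compactin X ((\<lambda>t. \<sigma> t p) ` I)" if "compact I" for I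
    using image_compactin[OF _ continuous_map_orbit[OF p]] that by simp
  then have closed_piece: "closedin X ((\<lambda>t. \<sigma> t p) ` I)" if "compact I" for I
    using that compactin_imp_closedin[OF Hausdorff] by blast
  define K where "K n = (\<lambda>t. \<sigma> t p) ` {- real n..real n}" for n
  have O_sub: "?O \<subseteq> topspace X"
    using flow_in_topspace[OF p] by (auto simp: orbit_def)
  have O_eq: "?O = (\<Union>n. K n)"
  proof -
    have "\<exists>n. t \<in> {- real n..real n}" for t
    proof -
      obtain n where "\<bar>t\<bar> \<le> real n"
        using real_arch_simple by blast
      then show ?thesis
        by (intro exI[of _ n]) auto
    qed
    then show ?thesis
      by (fastforce simp: orbit_def K_def)
  qed
  have regular: "regular_space X"
    using compact_Hausdorff_imp_regular_space[OF compact Hausdorff] .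
  \<comment> \<open>Local closedness enters here: the orbit is open in its closure, which is locally
    compact, and so Baire's theorem applies to the orbit.\<close>
  have "locally_compact_space ?S"
  proof -
    let ?Cl = "X closure_of ?O"
    have "locally_compact_space (subtopology X ?Cl)"
      by (intro locally_compact_space_closed_subset compact_imp_locally_compact_space compact closedin_closure_of)
    moreover have "regular_space (subtopology X ?Cl)"
      using regular by (rule regular_space_subtopology)
    moreover have "openin (subtopology X ?Cl) ?O"
      using lc by (simp add: locally_closed_in_def)
    ultimately have "locally_compact_space (subtopology (subtopology X ?Cl) ?O)"
      using locally_compact_space_open_subset by blast
    moreover have "?Cl \<inter> ?O = ?O"
      using closure_of_subset[OF O_sub] by blast
    ultimately show ?thesis
      by (simp add: subtopology_subtopology)
  qed
  moreover have "regular_space ?S"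
    using regular by (rule regular_space_subtopology)
  moreover have "closedin ?S (K n)" for n
  proof -
    have "closedin X (K n)"
      unfolding K_def by (rule closed_piece) simp
    moreover have "K n \<subseteq> ?O"
      using O_eq by blast
    ultimately show ?thesis
      by (rule closedin_subset_topspace)
  qed
  moreover have "?S interior_of (\<Union>(range K)) \<noteq> {}"
  proof -
    have "topspace ?S = ?O"
      using O_sub by (simp add: Int_absorb1)
    then have "?S interior_of (\<Union>(range K)) = ?O"
      using interior_of_topspace[of ?S] O_eq by simp
    then show ?thesis
      by (simp add: orbit_def)
  qed
  ultimately obtain n where "?S interior_of K n \<noteq> {}"
    using Baire_category_alt[of ?S "range K"] by auto
  then obtain q I where I: "openin ?S I" "I \<subseteq> K n" "q \<in> I"
    by (auto simp: interior_of_def)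
  then obtain W0 where W0: "openin X W0" "I = W0 \<inter> ?O"
    by (auto simp: openin_subtopology)
  then obtain a where a: "q = \<sigma> a p"
    using I(3) by (auto simp: orbit_def)
  \<comment> \<open>Pulling \<open>W0\<close> back by \<open>\<sigma> a\<close> moves the open piece
    from \<open>q\<close> to \<open>p\<close>. Orbit times in \<open>W1\<close>, shifted by
    \<open>a\<close>, lie in [-n, n].\<close>
  define W1 where "W1 = {x \<in> topspace X. \<sigma> a x \<in> W0}"
  have "openin X W1"
    unfolding W1_def by (rule openin_continuous_map_preimage[OF continuous_map_flow W0(1)])
  have "p \<in> W1"
    using p a I(3) W0(2) by (simp add: W1_def)
  define R where "R = real n + \<bar>a\<bar>"
  have R: "\<bar>s\<bar> \<le> R" if "\<sigma> s p \<in> W1" for s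
  proof -
    have "\<sigma> (a + s) p \<in> W0"
      using that flow_add[OF p, of a s] by (simp add: W1_def)
    then have "\<sigma> (a + s) p \<in> K n"
      using W0(2) I(2) by (auto simp: orbit_def)
    then obtain r where "r \<in> {- real n..real n}" "\<sigma> (a + s) p = \<sigma> r p"
      by (auto simp: K_def)
    then have "a + s = r" "\<bar>r\<bar> \<le> n"
      using inj by (auto simp: inj_eq dest: injD)
    then show ?thesis
      by (auto simp: R_def)
  qed
  \<comment> \<open>The orbit piece at the bounded times still to be excluded: compact, hence
    closed, and missing \<open>p\<close> by injectivity.\<close>
  define C where "C = (\<lambda>t. \<sigma> t p) ` ({-R..R} - {-\<delta><..<\<delta>})"
  have "closedin X C"
    unfolding C_def by (intro closed_piece compact_diff) auto
  have "p \<notin> C"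
  proof
    assume "p \<in> C"
    then obtain s where s: "p = \<sigma> s p" "s \<in> {-R..R} - {-\<delta><..<\<delta>}"
      unfolding C_def by (rule imageE)
    then have "\<sigma> s p = \<sigma> 0 p"
      using flow_zero[OF p] by simp
    then have "s = 0"
      using injD[OF inj] by blast
    then show False
      using s(2) \<open>\<delta> > 0\<close> by simp
  qed
  show ?thesis
  proof
    show "openin X (W1 - C)"
      by (rule openin_diff) fact+
    show "p \<in> W1 - C"
      using \<open>p \<in> W1\<close> \<open>p \<notin> C\<close> by simp
    show "\<bar>s\<bar> < \<delta>" if "\<sigma> s p \<in> W1 - C" for s
    proof (rule ccontr)
      assume "\<not> \<bar>s\<bar> < \<delta>"
      moreover have "\<bar>s\<bar> \<le> R"
        using R that by simp
      ultimately have "\<sigma> s p \<in> C"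
        unfolding C_def by (intro imageI) auto
      then show False
        using that by simp
    qed
  qed
qed

lemma not_locally_exponential_if_locally_closed_orbit:
  assumes p: "p \<in> topspace X" and nonper: "\<not> periodic_orbit \<sigma> p"
    and lc: "locally_closed_in X (orbit \<sigma> p)"
  shows "\<not> locally_exponential (flow_group_topology X A) (flow_group X A \<sigma>)"
proof
  assume "locally_exponential (flow_group_topology X A) (flow_group X A \<sigma>)"
  then obtain \<epsilon> where \<epsilon>: "\<epsilon> > 0"
    "\<And>g. g \<in> Cinf X A \<Longrightarrow> \<exists>F. (\<forall>t\<in>{0<..<\<epsilon>}. F t \<in> Cinf X A \<and>
        (\<forall>x\<in>topspace X. ((\<lambda>s. F t (\<sigma> s x)) has_integral t * g x) {0..t}) \<and>
        (\<forall>\<eta>>0. \<forall>\<^sub>F t' in at t. \<forall>x\<in>topspace X. \<bar>F t' x - F t x\<bar> < \<eta>))"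
    by (rule locally_exponential_imp_beta_inverse) (rule that)
  define t where "t = \<epsilon> / 2"
  \<comment> \<open>A quarter of \<open>t\<close> makes the two half-lines
    \<open>a > \<delta>\<close> and \<open>a < t - \<delta>\<close> overlap.\<close>
  define \<delta> where "\<delta> = t / 4"
  have t: "0 < t" "t < \<epsilon>" "t \<in> {0<..<\<epsilon>}" and \<delta>: "0 < \<delta>" "t = 4 * \<delta>"
    using \<epsilon>(1) by (auto simp: t_def \<delta>_def)
  obtain W where W: "openin X W" "p \<in> W" "\<And>s. \<sigma> s p \<in> W \<Longrightarrow> \<bar>s\<bar> < \<delta>"
    using locally_closed_orbit_wandering[OF p nonper lc \<delta>(1)] by metis
  obtain g where g: "g \<in> Cinf X A" "g p > 0" "\<And>x. x \<notin> W \<Longrightarrow> g x = 0"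
    using Cinf_bump[OF W(1,2)] by metis
  obtain F where F: "\<forall>t\<in>{0<..<\<epsilon>}. F t \<in> Cinf X A \<and>
        (\<forall>x\<in>topspace X. ((\<lambda>s. F t (\<sigma> s x)) has_integral t * g x) {0..t}) \<and>
        (\<forall>\<eta>>0. \<forall>\<^sub>F t' in at t. \<forall>x\<in>topspace X. \<bar>F t' x - F t x\<bar> < \<eta>)"
    using \<epsilon>(2)[OF g(1)] by (elim exE)
  define u where "u r s = F r (\<sigma> s p)" for r s
  have g0: "g (\<sigma> s p) = 0" if "\<bar>s\<bar> \<ge> \<delta>" for s
    using that W(3)[of s] g(3) by fastforce
  have primitive: "\<exists>U. (\<forall>s. (U has_field_derivative u r s) (at s)) \<and>
      (\<forall>s. U (s + r) - U s = r * g (\<sigma> s p))" if r: "r \<in> {0<..<\<epsilon>}" for r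
  proof -
    have Fr: "F r \<in> Cinf X A"
      and int: "\<forall>x\<in>topspace X. ((\<lambda>s. F r (\<sigma> s x)) has_integral r * g x) {0..r}"
      using bspec[OF F r, THEN conjunct1] bspec[OF F r, THEN conjunct2, THEN conjunct1] .
    have "r > 0"
      using r by simp
    obtain U where U: "\<And>s. (U has_field_derivative F r (\<sigma> s p)) (at s)"
      "\<And>s. U (s + r) - U s = r * g (\<sigma> s p)"
      using orbit_primitive[OF Fr p] int \<open>r > 0\<close> by metis
    then show ?thesis
      by (auto simp: u_def)
  qed
  \<comment> \<open>Differentiating the difference equation for \<open>U\<close> where its
    right-hand side is locally zero.\<close>
  have periodic: "u r (s + r) = u r s" if r: "r \<in> {0<..<\<epsilon>}" and s: "\<bar>s\<bar> > \<delta>" for r s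
  proof -
    obtain U where U: "\<And>s. (U has_field_derivative u r s) (at s)"
      "\<And>s. U (s + r) - U s = r * g (\<sigma> s p)"
      using primitive[OF r] by blast
    have "((\<lambda>s. U (s + r)) has_field_derivative u r (s + r)) (at s)"
      using U(1)[of "s + r"] by (simp add: DERIV_shift)
    from DERIV_diff[OF this U(1)]
    have "((\<lambda>s. U (s + r) - U s) has_field_derivative u r (s + r) - u r s) (at s)" .
    moreover have "((\<lambda>s. U (s + r) - U s) has_field_derivative 0) (at s)"
    proof (rule has_field_derivative_transform_within_open[of "\<lambda>_. 0" _ _ "{s. \<delta> < \<bar>s\<bar>}"])
      show "open {s. \<delta> < \<bar>s\<bar>}"
        by (intro open_Collect_less continuous_intros)
    qed (use s U(2) g0 in auto)
    ultimately have "u r (s + r) - u r s = 0"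
      by (rule DERIV_unique)
    then show ?thesis
      by simp
  qed
  have Ft: "F t \<in> Cinf X A"
    using bspec[OF F t(3)] by (elim conjE)
  have cont: "continuous_on S (u t)" for S
    unfolding u_def by (rule continuous_on_Cinf_orbit[OF Ft p])
  \<comment> \<open>Closeness on \<open>X\<close> is uniform, so it holds at all orbit times at
    once. Only \<open>r > t\<close> is considered: the treatment of the left end needs
    \<open>s + r > \<delta>\<close> whenever \<open>s > \<delta> - t\<close>.\<close>
  have close: "\<forall>\<^sub>F r in at_right t. r \<in> {t<..<\<epsilon>} \<and> (\<forall>s. \<bar>u r s - u t s\<bar> < \<eta>)" if "\<eta> > 0" for \<eta>
  proof -
    have "\<forall>\<^sub>F r in at t. \<forall>x\<in>topspace X. \<bar>F r x - F t x\<bar> < \<eta>"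
      using bspec[OF F t(3)] that by (elim conjE) (erule allE, erule mp)
    then have "\<forall>\<^sub>F r in at_right t. \<forall>x\<in>topspace X. \<bar>F r x - F t x\<bar> < \<eta>"
      by (rule filter_leD[OF at_le, rotated]) simp
    moreover have "\<forall>\<^sub>F r in at_right t. r \<in> {t<..<\<epsilon>}"
      by (rule eventually_at_right_real) fact
    ultimately show ?thesis
      by eventually_elim (use flow_in_topspace[OF p] in \<open>simp add: u_def\<close>)
  qed
  have right: "u t a = u t b" if "a > \<delta>" "b > \<delta>" for a b
  proof (rule limit_of_periodic_constant[where u = "u t" and v = u and c = \<delta>, OF cont t(1)])
    show "u t (s + t) = u t s" if "s > \<delta>" for s
      using periodic[OF t(3)] that by simp
    show "\<forall>\<^sub>F r in at_right t. \<forall>s>\<delta>. u r (s + r) = u r s \<and> \<bar>u r s - u t s\<bar> < \<eta>" if "\<eta> > 0" for \<eta>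
      using close[OF that] by eventually_elim (use t \<delta> in \<open>auto intro!: periodic\<close>)
  qed fact+
  \<comment> \<open>Time is reversed to reuse the statement about right half-lines. Periodicity at
    starting times below \<open>-\<delta>\<close> reaches up to \<open>t - \<delta>\<close> because
    the later time of each pair counts as well.\<close>
  have left: "u t a = u t b" if "a < t - \<delta>" "b < t - \<delta>" for a b
  proof -
    have "u t (- (- a)) = u t (- (- b))"
    proof (rule limit_of_periodic_constant[where u = "\<lambda>s. u t (- s)" and v = "\<lambda>r s. u r (- s)" and c = "\<delta> - t", OF _ t(1)])
      show "continuous_on {\<delta> - t<..} (\<lambda>s. u t (- s))"
        by (rule continuous_on_compose2[OF cont[of UNIV]]) (auto intro: continuous_intros)
      show "u t (- (s + t)) = u t (- s)" if "s > \<delta> - t" for s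
        using periodic[OF t(3), of "- (s + t)"] that by simp
      show "\<forall>\<^sub>F r in at_right t. \<forall>s>\<delta> - t. u r (- (s + r)) = u r (- s) \<and> \<bar>u r (- s) - u t (- s)\<bar> < \<eta>"
        if "\<eta> > 0" for \<eta>
        using close[OF that]
      proof eventually_elim
        case (elim r)
        have "u r (- (s + r)) = u r (- s)" if "s > \<delta> - t" for s
        proof -
          have "s + r > \<delta>"
            using that elim by auto
          then show ?thesis
            using periodic[of r "- (s + r)"] \<delta> elim t by simp
        qed
        then show ?case
          using elim by simp
      qed
    qed (use that in auto)
    then show ?thesis
      by simp
  qed
  obtain U where U: "\<And>s. (U has_field_derivative u t s) (at s)"
    "\<And>s. U (s + t) - U s = t * g (\<sigma> s p)"
    using primitive[OF t(3)] by blast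
  \<comment> \<open>The average of \<open>u t\<close> over [s, s + t] is
    \<open>g (\<sigma> s p)\<close>. At \<open>s = 2 * \<delta>\<close> and
    \<open>s = -2 * \<delta>\<close> it vanishes, which determines the two constants.\<close>
  have mvt: "\<exists>r. s < r \<and> r < s + t \<and> u t r = g (\<sigma> s p)" for s
  proof -
    obtain r where "s < r" "r < s + t" "U (s + t) - U s = (s + t - s) * u t r"
      using MVT2[of s "s + t" U "u t"] U(1) t(1) by auto
    then show ?thesis
      using U(2)[of s] t(1) by auto
  qed
  have zero_right: "u t a = 0" if "a > \<delta>" for a
  proof -
    obtain r where "2 * \<delta> < r" "u t r = g (\<sigma> (2 * \<delta>) p)"
      using mvt by blast
    then show ?thesis
      using right[OF that, of r] g0[of "2 * \<delta>"] \<delta> by simp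
  qed
  have zero_left: "u t a = 0" if "a < t - \<delta>" for a
  proof -
    obtain r where "r < - 2 * \<delta> + t" "u t r = g (\<sigma> (- 2 * \<delta>) p)"
      using mvt by blast
    then show ?thesis
      using left[OF that, of r] g0[of "- 2 * \<delta>"] \<delta> by simp
  qed
  \<comment> \<open>Since \<open>\<delta> < t - \<delta>\<close>, the two half-lines cover the line;
    the average starting at time 0 then contradicts \<open>g p > 0\<close>.\<close>
  have "u t a = 0" for a
    using zero_right[of a] zero_left[of a] \<delta> by linarith
  then have "g (\<sigma> 0 p) = 0"
    using mvt[of 0] by auto
  then show False
    using g(2) flow_zero[OF p] by simp
qed

end

theorem theorem2:
  fixes X :: "'a topology"
    and A :: "('a, 'e::euclidean_space) chart set"
    and \<sigma> :: "real \<Rightarrow> 'a \<Rightarrow> 'a"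
  assumes "smooth_manifold X A"
    and "compact_space X"
    and "smooth_flow X A \<sigma>"
    and "(\<exists>p\<in>topspace X. \<not> periodic_orbit \<sigma> p \<and> locally_closed_in X (orbit \<sigma> p))
       \<or> (\<exists>(\<theta> :: real ^ 'd) \<iota>. \<theta> \<noteq> 0 \<and> smooth_embedding torus torus_atlas X A \<iota> \<and>
            equivariant torus (linear_flow \<theta>) \<sigma> \<iota>)
       \<or> (\<exists>\<rho> \<pi>. smooth_flow circle circle_atlas \<rho> \<and> fixed_point_free circle \<rho> \<and>
            equivariant_submersion_onto X A \<sigma> circle circle_atlas \<rho> \<pi>)
       \<or> (\<exists>(\<theta> :: real ^ 'k) \<pi>. \<theta> \<noteq> 0 \<and>
            equivariant_submersion_onto X A \<sigma> torus torus_atlas (linear_flow \<theta>) \<pi>)"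
  shows "\<not> locally_exponential (flow_group_topology X A) (flow_group X A \<sigma>)"
proof -
  interpret compact_flow X A \<sigma>
    using assms(1,2) smooth_flow_imp_continuous_flow[OF assms(3)]
    by (intro compact_flow.intro compact_manifold.intro)
  from assms(4) show ?thesis
  proof (elim disjE exE bexE conjE)
    show ?thesis if "p \<in> topspace X" "\<not> periodic_orbit \<sigma> p" "locally_closed_in X (orbit \<sigma> p)" for p
      using that by (rule not_locally_exponential_if_locally_closed_orbit)
    show ?thesis if "\<theta> \<noteq> 0" "smooth_embedding torus torus_atlas X A \<iota>"
      "equivariant torus (linear_flow \<theta>) \<sigma> \<iota>" for \<theta> :: "real ^ 'd" and \<iota>
      using that by (rule not_locally_exponential_if_torus_embeds)
    show ?thesis if "smooth_flow circle circle_atlas \<rho>" "fixed_point_free circle \<rho>"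
      "equivariant_submersion_onto X A \<sigma> circle circle_atlas \<rho> \<pi>" for \<rho> \<pi>
      using that by (rule not_locally_exponential_if_submerses_circle)
    show ?thesis if "\<theta> \<noteq> 0"
      "equivariant_submersion_onto X A \<sigma> torus torus_atlas (linear_flow \<theta>) \<pi>" for \<theta> :: "real ^ 'k" and \<pi>
      using that by (rule not_locally_exponential_if_submerses_torus)
  qed
qed

end
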